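(* Algorithm 1 is a $\frac{6}{11}$-approximation algorithm for Closeness Ratio Improvement: on every instance $(G=(V,E),a,b,k)$ with $C_G(b)<C_G(a)$ it returns a set $S$ of at most $k$ non-edges of $G$ with $R_{G+S}(a,b)\ge\frac{6}{11}\cdot\mathrm{opt}$; moreover it can be implemented to run in $O((n+m)\log k)$ time, where $n=|V|$ and $m=|E|$.
   Context: All graphs are finite, simple, undirected, unweighted and connected. $d_G(u,v)$ is the shortest-path distance, $C_G(v)=\sum_{u\in V}d_G(u,v)$, $R_G(a,b)=\frac{\min(C_G(a),C_G(b))}{\max(C_G(a),C_G(b))}$. For a set $S$ of non-edges, $G+S=(V,E\cup S)$. $N_G(x)$ is the open and $N_G[x]=N_G(x)\cup\{x\}$ the closed neighborhood. Closeness Ratio Improvement: given $G$, $a,b\in V$, positive integer $k$, find a set $S$ of at most $k$ non-edges maximizing $R_{G+S}(a,b)$; $\mathrm{opt}$ is the maximum value. Algorithm 1 (input $(G,a,b,k)$ with $C_G(b)<C_G(a)$): set $S=\emptyset$. If $ab\notin E$, set $S=\{ab\}$, and if then $C_{G+S}(a)\le C_{G+S}(b)$, return whichever of $S$ and $\emptyset$ yields the larger closeness ratio. Then, while $|S|<k$: choose an arbitrary vertex $u\in N_{G+S}(b)\setminus N_{G+S}[a]$, set $S\leftarrow S\cup\{au\}$, and if $C_{G+S}(a)\le C_{G+S}(b)$, return whichever of $S$ and $S\setminus\{au\}$ yields the larger closeness ratio. When the loop ends, return whichever of $S$ and $\emptyset$ yields the larger closeness ratio. *)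

theory Defs
  imports Complex_Main
begin

section \<open>Graphs and closeness\<close>

type_synonym 'a ugraph = "'a set \<times> 'a set set"

abbreviation verts :: "'a ugraph \<Rightarrow> 'a set" where "verts G \<equiv> fst G"
abbreviation edges :: "'a ugraph \<Rightarrow> 'a set set" where "edges G \<equiv> snd G"

definition vpairs :: "'a set \<Rightarrow> 'a set set" where
  "vpairs V = {{u, v} | u v. u \<in> V \<and> v \<in> V \<and> u \<noteq> v}"

definition simple_graph :: "'a ugraph \<Rightarrow> bool" where
  "simple_graph G \<longleftrightarrow> finite (verts G) \<and> edges G \<subseteq> vpairs (verts G)"

definition adj_rel :: "'a ugraph \<Rightarrow> ('a \<times> 'a) set" where
  "adj_rel G = {(u, v). {u, v} \<in> edges G}"

definition connected_graph :: "'a ugraph \<Rightarrow> bool" where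
  "connected_graph G \<longleftrightarrow> (\<forall>u \<in> verts G. \<forall>v \<in> verts G. (u, v) \<in> (adj_rel G)\<^sup>*)"

text \<open>The pairs in \<open>adj_rel G ^^ l\<close> are those joined by a walk of length \<open>l\<close>. The value is
  meaningful only for vertices in the same component.\<close>

definition gdist :: "'a ugraph \<Rightarrow> 'a \<Rightarrow> 'a \<Rightarrow> nat" where
  "gdist G u v = (LEAST l. (u, v) \<in> adj_rel G ^^ l)"

definition total_dist :: "'a ugraph \<Rightarrow> 'a \<Rightarrow> nat" where
  "total_dist G v = (\<Sum>u \<in> verts G. gdist G u v)"

definition closeness_ratio :: "'a ugraph \<Rightarrow> 'a \<Rightarrow> 'a \<Rightarrow> real" where
  "closeness_ratio G a b =
     real (min (total_dist G a) (total_dist G b)) / real (max (total_dist G a) (total_dist G b))"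

definition non_edges :: "'a ugraph \<Rightarrow> 'a set set" where
  "non_edges G = vpairs (verts G) - edges G"

definition add_edges :: "'a ugraph \<Rightarrow> 'a set set \<Rightarrow> 'a ugraph" where
  "add_edges G S = (verts G, edges G \<union> S)"

definition nbrs :: "'a ugraph \<Rightarrow> 'a \<Rightarrow> 'a set" where
  "nbrs G x = {y. {x, y} \<in> edges G}"

definition closed_nbrs :: "'a ugraph \<Rightarrow> 'a \<Rightarrow> 'a set" where
  "closed_nbrs G x = insert x (nbrs G x)"


section \<open>Closeness Ratio Improvement\<close>

definition feasible :: "'a ugraph \<Rightarrow> nat \<Rightarrow> 'a set set set" where
  "feasible G k = {S. S \<subseteq> non_edges G \<and> card S \<le> k}"

definition opt :: "'a ugraph \<Rightarrow> 'a \<Rightarrow> 'a \<Rightarrow> nat \<Rightarrow> real" where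
  "opt G a b k = Max ((\<lambda>S. closeness_ratio (add_edges G S) a b) ` feasible G k)"

definition alg_input :: "'a ugraph \<Rightarrow> 'a \<Rightarrow> 'a \<Rightarrow> nat \<Rightarrow> bool" where
  "alg_input G a b k \<longleftrightarrow>
     simple_graph G \<and> connected_graph G \<and> a \<in> verts G \<and> b \<in> verts G \<and> 0 < k \<and>
     total_dist G b < total_dist G a"


section \<open>The algorithm\<close>

text \<open>The algorithm is nondeterministic: the vertex \<open>u\<close> is arbitrary, and so is the returned set
  when both candidates have the same ratio. It is therefore given as a transition relation;
  \<open>Loop S\<close> is the configuration in which the loop condition is about to be tested.\<close>

datatype 'a config = Start | Loop "'a set set" | Return "'a set set"

definition larger_ratio :: "'a ugraph \<Rightarrow> 'a \<Rightarrow> 'a \<Rightarrow> 'a set set \<Rightarrow> 'a set set \<Rightarrow> 'a set set \<Rightarrow> bool"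
  where
  "larger_ratio G a b S T X \<longleftrightarrow>
     (X = S \<and> closeness_ratio (add_edges G T) a b \<le> closeness_ratio (add_edges G S) a b) \<or>
     (X = T \<and> closeness_ratio (add_edges G S) a b \<le> closeness_ratio (add_edges G T) a b)"

inductive alg_step :: "'a ugraph \<Rightarrow> 'a \<Rightarrow> 'a \<Rightarrow> nat \<Rightarrow> 'a config \<Rightarrow> 'a config \<Rightarrow> bool"
  for G a b k where
  adjacent:
    "{a, b} \<in> edges G \<Longrightarrow> alg_step G a b k Start (Loop {})"
| join:
    "{a, b} \<notin> edges G \<Longrightarrow> S = {{a, b}} \<Longrightarrow>
     \<not> total_dist (add_edges G S) a \<le> total_dist (add_edges G S) b \<Longrightarrow>
     alg_step G a b k Start (Loop S)"
| join_return:
    "{a, b} \<notin> edges G \<Longrightarrow> S = {{a, b}} \<Longrightarrow>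
     total_dist (add_edges G S) a \<le> total_dist (add_edges G S) b \<Longrightarrow>
     larger_ratio G a b S {} X \<Longrightarrow>
     alg_step G a b k Start (Return X)"
| extend:
    "card S < k \<Longrightarrow> u \<in> nbrs (add_edges G S) b - closed_nbrs (add_edges G S) a \<Longrightarrow>
     S' = S \<union> {{a, u}} \<Longrightarrow>
     \<not> total_dist (add_edges G S') a \<le> total_dist (add_edges G S') b \<Longrightarrow>
     alg_step G a b k (Loop S) (Loop S')"
| extend_return:
    "card S < k \<Longrightarrow> u \<in> nbrs (add_edges G S) b - closed_nbrs (add_edges G S) a \<Longrightarrow>
     S' = S \<union> {{a, u}} \<Longrightarrow>
     total_dist (add_edges G S') a \<le> total_dist (add_edges G S') b \<Longrightarrow>
     larger_ratio G a b S' (S' - {{a, u}}) X \<Longrightarrow>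
     alg_step G a b k (Loop S) (Return X)"
| finish:
    "\<not> card S < k \<Longrightarrow> larger_ratio G a b S {} X \<Longrightarrow>
     alg_step G a b k (Loop S) (Return X)"

abbreviation alg_steps :: "'a ugraph \<Rightarrow> 'a \<Rightarrow> 'a \<Rightarrow> nat \<Rightarrow> 'a config \<Rightarrow> 'a config \<Rightarrow> bool" where
  "alg_steps G a b k \<equiv> (alg_step G a b k)\<^sup>*\<^sup>*"

definition alg_terminates :: "'a ugraph \<Rightarrow> 'a \<Rightarrow> 'a \<Rightarrow> nat \<Rightarrow> bool" where
  "alg_terminates G a b k \<longleftrightarrow>
     \<not> (\<exists>f :: nat \<Rightarrow> 'a config. f 0 = Start \<and> (\<forall>i. alg_step G a b k (f i) (f (Suc i))))"

text \<open>A run that got stuck because there is no vertex \<open>u\<close> to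
  choose would halt in some \<open>Loop S\<close>.\<close>

definition alg_halts_in :: "'a ugraph \<Rightarrow> 'a \<Rightarrow> 'a \<Rightarrow> nat \<Rightarrow> 'a config \<Rightarrow> bool" where
  "alg_halts_in G a b k c \<longleftrightarrow> alg_steps G a b k Start c \<and> (\<nexists>c'. alg_step G a b k c c')"


section \<open>Machine model for running time\<close>

text \<open>A random access machine with uniform cost, programmed by structured programs. Its memory is
  organised as arrays of natural numbers (a program only mentions finitely many of them); a
  scalar \<open>x\<close> is the cell \<open>x[0]\<close>. The only arithmetic is addition and truncated subtraction:
  with unit-cost multiplication on unbounded numbers the model would be too powerful. Every node
  of an evaluated expression and every executed command costs one time unit.\<close>

type_synonym memory = "string \<Rightarrow> nat \<Rightarrow> nat"

datatype expr = Const nat | Read string expr | Plus expr expr | Minus expr expr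

datatype prog =
    Skip
  | Write string expr expr
  | Seq prog prog
  | IfLess expr expr prog prog
  | WhileLess expr expr prog

fun eval_expr :: "expr \<Rightarrow> memory \<Rightarrow> nat" where
  "eval_expr (Const c) s = c"
| "eval_expr (Read x e) s = s x (eval_expr e s)"
| "eval_expr (Plus e1 e2) s = eval_expr e1 s + eval_expr e2 s"
| "eval_expr (Minus e1 e2) s = eval_expr e1 s - eval_expr e2 s"

fun expr_cost :: "expr \<Rightarrow> nat" where
  "expr_cost (Const c) = 1"
| "expr_cost (Read x e) = 1 + expr_cost e"
| "expr_cost (Plus e1 e2) = 1 + expr_cost e1 + expr_cost e2"
| "expr_cost (Minus e1 e2) = 1 + expr_cost e1 + expr_cost e2"

text \<open>\<open>runs p s t s'\<close>: started in memory \<open>s\<close>, program \<open>p\<close> halts after \<open>t\<close> time units in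
  memory \<open>s'\<close>.\<close>

inductive runs :: "prog \<Rightarrow> memory \<Rightarrow> nat \<Rightarrow> memory \<Rightarrow> bool" where
  Skip:
    "runs Skip s 1 s"
| Write:
    "runs (Write x i e) s (1 + expr_cost i + expr_cost e)
       (s(x := (s x)(eval_expr i s := eval_expr e s)))"
| Seq:
    "runs p s t s' \<Longrightarrow> runs q s' t' s'' \<Longrightarrow> runs (Seq p q) s (1 + t + t') s''"
| IfTrue:
    "eval_expr e1 s < eval_expr e2 s \<Longrightarrow> runs p s t s' \<Longrightarrow>
     runs (IfLess e1 e2 p q) s (1 + expr_cost e1 + expr_cost e2 + t) s'"
| IfFalse:
    "\<not> eval_expr e1 s < eval_expr e2 s \<Longrightarrow> runs q s t s' \<Longrightarrow>
     runs (IfLess e1 e2 p q) s (1 + expr_cost e1 + expr_cost e2 + t) s'"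
| WhileTrue:
    "eval_expr e1 s < eval_expr e2 s \<Longrightarrow> runs p s t s' \<Longrightarrow>
     runs (WhileLess e1 e2 p) s' t' s'' \<Longrightarrow>
     runs (WhileLess e1 e2 p) s (1 + expr_cost e1 + expr_cost e2 + t + t') s''"
| WhileFalse:
    "\<not> eval_expr e1 s < eval_expr e2 s \<Longrightarrow>
     runs (WhileLess e1 e2 p) s (1 + expr_cost e1 + expr_cost e2) s"

lemma runs_deterministic:
  "runs p s t s' \<Longrightarrow> runs p s u s'' \<Longrightarrow> t = u \<and> s' = s''"
proof (induction arbitrary: u s'' rule: runs.induct)
  case (Seq p s t s' q t' s2)
  from Seq.prems show ?case by (cases rule: runs.cases) (use Seq.IH in blast)+
next
  case (WhileTrue e1 s e2 p t s' t' s2)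
  from WhileTrue.prems show ?case
    by (cases rule: runs.cases) (use WhileTrue.IH WhileTrue.hyps in blast)+
next
  case (IfTrue e1 s e2 p t s' q)
  from IfTrue.prems show ?case
    by (cases rule: runs.cases) (use IfTrue.IH IfTrue.hyps in blast)+
next
  case (IfFalse e1 s e2 q t s' p)
  from IfFalse.prems show ?case
    by (cases rule: runs.cases) (use IfFalse.IH IfFalse.hyps in blast)+
qed (auto elim: runs.cases)

text \<open>The input graph has vertices \<open>0, \<dots>, n - 1\<close> and is given by adjacency lists stored
  consecutively: the neighbours of \<open>v\<close>, each listed once and in any order, are the entries of
  \<open>adj\<close> at the positions from \<open>off[v]\<close> up to but excluding \<open>off[v + 1]\<close>. All cells not
  mentioned have arbitrary contents.\<close>

definition encodes_input :: "memory \<Rightarrow> nat ugraph \<Rightarrow> nat \<Rightarrow> nat \<Rightarrow> nat \<Rightarrow> bool" where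
  "encodes_input s G a b k \<longleftrightarrow>
     verts G = {..<s ''n'' 0} \<and> s ''a'' 0 = a \<and> s ''b'' 0 = b \<and> s ''k'' 0 = k \<and>
     s ''off'' 0 = 0 \<and>
     (\<forall>v \<in> verts G. s ''off'' v \<le> s ''off'' (Suc v) \<and>
        bij_betw (s ''adj'') {s ''off'' v..<s ''off'' (Suc v)} (nbrs G v))"

definition output_edges :: "memory \<Rightarrow> nat set set" where
  "output_edges s = {{s ''out1'' i, s ''out2'' i} | i. i < s ''out_count'' 0}"

definition implements_alg :: "prog \<Rightarrow> bool" where
  "implements_alg p \<longleftrightarrow>
     (\<forall>G a b k s. alg_input G a b k \<and> encodes_input s G a b k \<longrightarrow>
        (\<exists>t s'. runs p s t s' \<and> alg_steps G a b k Start (Return (output_edges s'))))"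

text \<open>The bound \<open>O((n + m) log k)\<close>. As \<open>log 1 = 0\<close>, the logarithmic factor is read as at least 1;
  for \<open>k \<ge> 2\<close> the maximum is just \<open>log 2 k\<close>.\<close>

definition runs_in_time :: "prog \<Rightarrow> bool" where
  "runs_in_time p \<longleftrightarrow>
     (\<exists>c :: real. \<forall>G a b k s t s'.
        alg_input G a b k \<and> encodes_input s G a b k \<and> runs p s t s' \<longrightarrow>
        real t \<le> c * (real (card (verts G) + card (edges G)) * max 1 (log 2 (real k))))"

end

theory Submission
  imports Defs
begin

text \<open>
  For \<^emph>\<open>adjacent\<close> \<open>a\<close> and \<open>b\<close> the distances of a vertex to \<open>a\<close> and to \<open>b\<close> differ by at most one, so
  the ratio is governed by the numbers \<open>p\<close> and \<open>q\<close> of vertices closer to \<open>a\<close> and closer to \<open>b\<close>. A ratio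
  below \<open>6/11\<close> forces one of them to be more than 16 times the other and most vertices to be
  adjacent to the closer one of \<open>a\<close> and \<open>b\<close>. This cannot hold both before and after an added edge
  \<open>au\<close> changes the sign of \<open>C(a) - C(b)\<close>. If the edge \<open>ab\<close> changes the sign, then \<open>p > 16 q\<close> while
  \<open>p < q d(a,b)\<close>, so \<open>a\<close> and \<open>b\<close> were far apart and the vertices closer to \<open>a\<close> are on average far from
  \<open>a\<close> as well, which contradicts a bad ratio. If the budget \<open>k\<close> is exhausted before the sign changes,
  a bad ratio also bounds the optimum.

  Since the added edges join \<open>a\<close> to \<open>b\<close> and to neighbours of \<open>b\<close>, adding them never changes the
  distances to \<open>b\<close> (after \<open>ab\<close> is present), and lowers the distance of \<open>x\<close> to \<open>a\<close> by at most one,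
  namely as soon as \<open>a\<close> is joined to the first vertex of a shortest path from \<open>b\<close> to \<open>x\<close>. The
  values \<open>C(a)\<close> for all prefixes of the sequence of added edges are therefore obtained from two
  breadth-first searches and one propagation pass, and the time bound holds even without the
  logarithmic factor.
\<close>

section \<open>The approximation ratio\<close>

lemma vpairs_iff: "{u, v} \<in> vpairs V \<longleftrightarrow> u \<in> V \<and> v \<in> V \<and> u \<noteq> v"
  by (auto simp: vpairs_def doubleton_eq_iff)

lemma finite_vpairs: "finite V \<Longrightarrow> finite (vpairs V)"
  by (rule finite_subset[of _ "Pow V"]) (auto simp: vpairs_def)

lemma verts_add_edges [simp]: "verts (add_edges G S) = verts G"
  by (simp add: add_edges_def)

lemma edges_add_edges [simp]: "edges (add_edges G S) = edges G \<union> S"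
  by (simp add: add_edges_def)

lemma add_edges_add_edges [simp]: "add_edges (add_edges G S) T = add_edges G (S \<union> T)"
  by (simp add: add_edges_def Un_assoc)

lemma add_edges_empty [simp]: "add_edges G {} = G"
  by (simp add: add_edges_def)

section \<open>Distances in a connected graph\<close>

locale conn_graph =
  fixes G :: "'a ugraph"
  assumes simple: "simple_graph G" and conn: "connected_graph G"
begin

abbreviation V where "V \<equiv> verts G"
abbreviation d where "d \<equiv> gdist G"

lemma finite_V [simp, intro]: "finite V"
  using simple by (simp add: simple_graph_def)

lemma edge_verts: "{u, v} \<in> edges G \<Longrightarrow> u \<in> V \<and> v \<in> V \<and> u \<noteq> v"
  using simple by (auto simp: simple_graph_def simp flip: vpairs_iff)

lemma finite_edges: "finite (edges G)"
  using simple finite_subset[OF _ finite_vpairs[OF finite_V]] by (simp add: simple_graph_def)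

lemma walk_sym: "(u, v) \<in> adj_rel G ^^ l \<Longrightarrow> (v, u) \<in> adj_rel G ^^ l"
proof (induction l arbitrary: v)
  case (Suc l)
  then obtain w where "(u, w) \<in> adj_rel G ^^ l" "(w, v) \<in> adj_rel G" by auto
  then have "(w, u) \<in> adj_rel G ^^ l" "(v, w) \<in> adj_rel G"
    using Suc.IH by (auto simp: adj_rel_def insert_commute)
  then show ?case by (rule relpow_Suc_I2[rotated])
qed auto

lemma dist_sym: "d u v = d v u"
  unfolding gdist_def by (rule arg_cong[of _ _ Least]) (auto intro: walk_sym)

lemma dist_le: "(u, v) \<in> adj_rel G ^^ l \<Longrightarrow> d u v \<le> l"
  unfolding gdist_def by (rule Least_le)

lemma dist_walk:
  assumes "u \<in> V" "v \<in> V"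
  shows "(u, v) \<in> adj_rel G ^^ d u v"
proof -
  have "\<exists>l. (u, v) \<in> adj_rel G ^^ l"
    using assms conn by (auto simp: connected_graph_def rtrancl_power)
  then show ?thesis unfolding gdist_def by (rule LeastI_ex)
qed

lemma dist_self [simp]: "d u u = 0"
  using dist_le[of u u 0] by simp

lemma dist_0_iff [simp]: "u \<in> V \<Longrightarrow> v \<in> V \<Longrightarrow> d u v = 0 \<longleftrightarrow> u = v"
  using dist_walk[of u v] by auto

lemma dist_triangle:
  assumes "u \<in> V" "v \<in> V" "w \<in> V"
  shows "d u w \<le> d u v + d v w"
  using dist_le[of u w "d u v + d v w"] dist_walk[of u v] dist_walk[of v w] assms
  by (auto simp: relpow_add)

lemma dist_edge_1: "{u, v} \<in> edges G \<Longrightarrow> d u v = 1"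
  using dist_le[of u v 1] dist_0_iff[of u v] edge_verts[of u v]
  by (cases "d u v") (auto simp: adj_rel_def)

lemma dist_edge: "{u, v} \<in> edges G \<Longrightarrow> w \<in> V \<Longrightarrow> d v w \<le> d u w + 1"
  using dist_triangle[of v u w] dist_edge_1[of v u] edge_verts[of u v]
  by (simp add: insert_commute)

lemma dist_1_iff: "u \<in> V \<Longrightarrow> v \<in> V \<Longrightarrow> d u v = 1 \<longleftrightarrow> {u, v} \<in> edges G"
  using dist_walk[of u v] dist_edge_1[of u v] by (auto simp: adj_rel_def)

lemma dist_pred:
  assumes "u \<in> V" "v \<in> V" "d u v = Suc l"
  obtains w where "{u, w} \<in> edges G" "w \<in> V" "d w v = l"
proof -
  have "(u, v) \<in> adj_rel G ^^ Suc l" using dist_walk[OF assms(1,2)] assms(3) by simp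
  then obtain w where w: "(u, w) \<in> adj_rel G" "(w, v) \<in> adj_rel G ^^ l"
    by (blast dest: relpow_Suc_D2)
  then have e: "{u, w} \<in> edges G" by (simp add: adj_rel_def)
  then have "d u v \<le> d w v + 1" using dist_edge[of w u v] assms by (simp add: insert_commute)
  then have "d w v = l" using dist_le[OF w(2)] assms by simp
  then show thesis using that e edge_verts by blast
qed

text \<open>Lower bounds for distances are always obtained from a potential that grows by at most one
  along every edge.\<close>

lemma potential_le_dist:
  assumes f: "\<And>x y. {x, y} \<in> edges G \<Longrightarrow> f y \<le> f x + (1::nat)"
    and "f v = 0" "u \<in> V" "v \<in> V"
  shows "f u \<le> d u v"
proof -
  have "(v, u) \<in> adj_rel G ^^ l \<Longrightarrow> f u \<le> f v + l" for u l
  proof (induction l arbitrary: u)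
    case (Suc l)
    then obtain w where "(v, w) \<in> adj_rel G ^^ l" "(w, u) \<in> adj_rel G" by auto
    then show ?case using Suc.IH[of w] f[of w u] by (simp add: adj_rel_def)
  qed auto
  from this[OF dist_walk[of v u]] show ?thesis using assms dist_sym[of u v] by simp
qed

lemma conn_graph_add_edges:
  assumes "S \<subseteq> vpairs V"
  shows "conn_graph (add_edges G S)"
proof
  show "simple_graph (add_edges G S)" using simple assms by (auto simp: simple_graph_def)
  have "(adj_rel G)\<^sup>* \<subseteq> (adj_rel (add_edges G S))\<^sup>*"
    by (rule rtrancl_mono) (auto simp: adj_rel_def)
  then show "connected_graph (add_edges G S)" using conn by (auto simp: connected_graph_def)
qed

lemma dist_add_edges_le:
  assumes "S \<subseteq> vpairs V" "u \<in> V" "v \<in> V"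
  shows "gdist (add_edges G S) u v \<le> d u v"
proof -
  interpret H: conn_graph "add_edges G S" by (rule conn_graph_add_edges) fact
  have "adj_rel G ^^ l \<subseteq> adj_rel (add_edges G S) ^^ l" for l
    by (induction l) (auto simp: adj_rel_def)
  then show ?thesis using dist_walk[OF assms(2,3)] by (blast intro: H.dist_le)
qed

lemma total_dist_pos:
  assumes "v \<in> V" "u \<in> V" "u \<noteq> v"
  shows "0 < total_dist G v"
  using assms by (auto simp: total_dist_def sum_nonneg_eq_0_iff intro!: gr0I)

lemma sum_split2:
  assumes "a \<in> V" "b \<in> V" "a \<noteq> b"
  shows "sum f V = f a + f b + sum f (V - {a, b})"
  using assms sum.subset_diff[of "{a, b}" V f] by (simp add: ac_simps)

section \<open>Joining \<open>a\<close> to \<open>b\<close>\<close>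

lemma dist_join:
  assumes ab: "a \<in> V" "b \<in> V" "a \<noteq> b" and x: "x \<in> V"
  shows "gdist (add_edges G {{a, b}}) x a = min (d x a) (d x b + 1)"
    (is "gdist ?H x a = ?f x")
proof -
  have S: "{{a, b}} \<subseteq> vpairs V" using ab by (simp add: vpairs_iff)
  interpret H: conn_graph ?H by (rule conn_graph_add_edges) fact
  show ?thesis
  proof (rule antisym)
    have "gdist ?H x a \<le> gdist ?H x b + gdist ?H b a" using H.dist_triangle[of x b a] ab x by simp
    moreover have "gdist ?H b a = 1" using H.dist_edge_1[of b a] by (simp add: insert_commute)
    ultimately show "gdist ?H x a \<le> ?f x"
      using dist_add_edges_le[OF S x ab(1)] dist_add_edges_le[OF S x ab(2)] by simp
    \<comment> \<open>The new edge respects the potential because \<open>?f\<close> is 0 at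
      \<open>a\<close> and at most 1 at \<open>b\<close>.\<close>
    have lip: "?f z \<le> ?f y + 1" if "{y, z} \<in> edges ?H" for y z
    proof (cases "{y, z} \<in> edges G")
      case True
      then show ?thesis using dist_edge[OF True ab(1)] dist_edge[OF True ab(2)] by auto
    next
      case False
      then have "{y, z} = {a, b}" using that by simp
      then show ?thesis by (auto simp: doubleton_eq_iff)
    qed
    show "?f x \<le> gdist ?H x a"
      by (rule H.potential_le_dist[where f = ?f]) (use lip ab x in auto)
  qed
qed

lemma ratio_bounds:
  "closeness_ratio G a b \<le> 1"
  by (auto simp: closeness_ratio_def divide_le_eq)

lemma join_ratio:
  assumes ab: "a \<in> V" "b \<in> V" "{a, b} \<notin> edges G" and less: "total_dist G b < total_dist G a"
    and le: "total_dist (add_edges G {{a, b}}) a \<le> total_dist (add_edges G {{a, b}}) b"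
  shows "6 / 11 \<le> closeness_ratio (add_edges G {{a, b}}) a b"
proof -
  have ne: "a \<noteq> b" using less by auto
  define H where "H = add_edges G {{a, b}}"
  interpret H: conn_graph H unfolding H_def
    by (rule conn_graph_add_edges) (use ab ne in \<open>simp add: vpairs_iff\<close>)
  define W where "W = V - {a, b}"
  have W: "x \<in> V" "0 < d x a" "0 < d x b" if "x \<in> W" for x
    using that ab by (auto simp: W_def intro!: gr0I)
  define D where "D = d a b"
  have Ha: "gdist H x a = min (d x a) (d x b + 1)" and Hb: "gdist H x b = min (d x b) (d x a + 1)"
    if "x \<in> V" for x
    using dist_join[of a b x] dist_join[of b a x] ab ne that by (auto simp: H_def insert_commute)
  define ip iq where "ip x = (if d x a < d x b then 1 else 0 :: int)"
    and "iq x = (if d x b < d x a then 1 else 0 :: int)" for x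
  define p q I where "p = sum ip W" and "q = sum iq W" and "I = (\<Sum>x\<in>W. ip x * int (d x a))"
  define A' B' where "A' = int (total_dist H a)" and "B' = int (total_dist H b)"
  have nn: "0 \<le> p" "0 \<le> q" by (auto simp: p_def q_def ip_def iq_def intro!: sum_nonneg)
  have D0: "D > 0" using ab ne by (auto simp: D_def intro!: gr0I)
  have H1: "gdist H a b = 1" "gdist H b a = 1"
    using Ha[of b] Hb[of a] D0 ab dist_sym[of a b] by (auto simp: D_def)
  have vH: "verts H = V" by (simp add: H_def)
  have A'W: "A' = 1 + (\<Sum>x\<in>W. int (gdist H x a))"
    using sum_split2[OF ab(1,2) ne, of "\<lambda>x. int (gdist H x a)"] H1
    by (simp add: A'_def W_def total_dist_def vH)
  have B'W: "B' = 1 + (\<Sum>x\<in>W. int (gdist H x b))"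
    using sum_split2[OF ab(1,2) ne, of "\<lambda>x. int (gdist H x b)"] H1
    by (simp add: B'_def W_def total_dist_def vH)
  have "B' - A' = (\<Sum>x\<in>W. int (gdist H x b) - int (gdist H x a))"
    by (simp add: A'W B'W sum_subtractf)
  also have "\<dots> = (\<Sum>x\<in>W. ip x - iq x)"
    by (rule sum.cong) (auto simp: Ha Hb W ip_def iq_def)
  finally have diff: "B' - A' = p - q" by (simp add: sum_subtractf p_def q_def)
  \<comment> \<open>A vertex closer to \<open>b\<close> has distance
    \<open>d x b + 1 \<ge> 2\<close> to \<open>a\<close> in \<open>H\<close>; this is the
    coefficient of \<open>q\<close>.\<close>
  have "p + 2 * q = (\<Sum>x\<in>W. ip x + 2 * iq x)" by (simp add: p_def q_def sum.distrib sum_distrib_left)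
  also have "\<dots> \<le> (\<Sum>x\<in>W. int (gdist H x a))"
    by (rule sum_mono) (auto simp: Ha W ip_def iq_def dest: W(2,3))
  finally have A'1: "1 + p + 2 * q \<le> A'" using A'W by simp
  have "I \<le> (\<Sum>x\<in>W. int (gdist H x a))" unfolding I_def
    by (rule sum_mono) (auto simp: Ha W ip_def)
  then have A'2: "I \<le> A'" using A'W by simp
  have "0 < (\<Sum>x\<in>V. int (d x a) - int (d x b))"
    using less by (simp add: total_dist_def sum_subtractf flip: of_nat_sum)
  also have "\<dots> = (\<Sum>x\<in>W. int (d x a) - int (d x b))"
    using sum_split2[OF ab(1,2) ne, of "\<lambda>x. int (d x a) - int (d x b)"] dist_sym[of a b]
    by (simp add: W_def)
  finally have pos: "0 < (\<Sum>x\<in>W. int (d x a) - int (d x b))" .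
  have tri: "d x a \<le> D + d x b" "D \<le> d x a + d x b" if "x \<in> W" for x
    using dist_triangle[of x b a] dist_triangle[of a x b] dist_sym[of a b] dist_sym[of a x] W[OF that] ab
    by (auto simp: D_def)
  \<comment> \<open>By the triangle inequality a vertex closer to \<open>b\<close> contributes at
    most \<open>D\<close>; one closer to \<open>a\<close> contributes at most -1.\<close>
  have "(\<Sum>x\<in>W. int (d x a) - int (d x b)) \<le> (\<Sum>x\<in>W. int D * iq x - ip x)"
    by (rule sum_mono) (auto simp: ip_def iq_def dest: tri)
  then have qD: "p < q * int D" using pos
    by (simp add: sum_subtractf p_def q_def sum_distrib_left mult.commute)
  \<comment> \<open>For a vertex closer to \<open>a\<close>, the bound
    \<open>d x b \<ge> D - d x a\<close> makes its term at most \<open>2 * d x a - D\<close>. So if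
    these vertices are many, their distances to \<open>a\<close> sum up to a lot.\<close>
  have "(\<Sum>x\<in>W. int (d x a) - int (d x b))
      \<le> (\<Sum>x\<in>W. 2 * (ip x * int (d x a)) - ip x * int D + iq x * int D)"
    by (rule sum_mono) (use tri in \<open>force simp: ip_def iq_def\<close>)
  also have "\<dots> = 2 * I - p * int D + q * int D"
    by (simp add: sum_subtractf sum.distrib p_def q_def I_def sum_distrib_left sum_distrib_right)
  finally have I: "(p - q) * int D < 2 * I" using pos by (simp add: algebra_simps)
  \<comment> \<open>A ratio below 6/11 means \<open>5 A' < 6 (p - q)\<close>. With
    \<open>A' \<ge> 1 + p + 2 q\<close> this gives \<open>p > 16 q\<close>, and
    \<open>p < q D\<close> then forces \<open>D > 16\<close>. Hence
    \<open>8 (p - q) < I \<le> A'\<close>, against \<open>A' < 6/5 (p - q)\<close>.\<close>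
  have main: "6 * B' \<le> 11 * A'"
  proof (rule ccontr)
    assume "\<not> ?thesis"
    then have bad: "5 * A' < 6 * (p - q)" using diff by simp
    then have p16: "16 * q < p" using A'1 by simp
    then have "16 * q < q * int D" using qD by simp
    then have "16 < int D" using nn by (simp add: mult.commute mult_less_cancel_left)
    then have "(p - q) * 16 \<le> (p - q) * int D" by (intro mult_left_mono) (use p16 nn in auto)
    then have "(p - q) * 16 < 2 * I" using I by (rule le_less_trans)
    then show False using A'2 bad p16 nn by (simp add: algebra_simps)
  qed
  have "0 < B'" using A'1 nn le by (simp add: A'_def B'_def H_def)
  then show ?thesis using main le
    by (simp add: closeness_ratio_def A'_def B'_def min_def max_def field_simps flip: H_def)
qed

section \<open>Adding one edge \<open>au\<close> when \<open>a\<close> and \<open>b\<close> are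
  adjacent\<close>

lemma dist_star_edge_b:
  assumes ab: "{a, b} \<in> edges G" and u: "{b, u} \<in> edges G" "{a, u} \<notin> edges G" "u \<noteq> a" and x: "x \<in> V"
  shows "gdist (add_edges G {{a, u}}) x b = d x b"
    and "min (d x a) (d x b) \<le> gdist (add_edges G {{a, u}}) x a"
proof -
  let ?H = "add_edges G {{a, u}}"
  have V: "a \<in> V" "b \<in> V" "u \<in> V" using edge_verts ab u by blast+
  have S: "{{a, u}} \<subseteq> vpairs V" using V u by (simp add: vpairs_iff)
  interpret H: conn_graph ?H by (rule conn_graph_add_edges) fact
  have 1: "d a b = 1" "d u b = 1" using dist_edge_1 ab u by (simp_all add: insert_commute)
  \<comment> \<open>Both \<open>a\<close> and \<open>u\<close> are at distance 1 from
    \<open>b\<close>, so the new edge joins points of equal potential.\<close>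
  have lip: "d z b \<le> d y b + 1" if "{y, z} \<in> edges ?H" for y z
    using that dist_edge[of y z b] V 1 by (auto simp: doubleton_eq_iff)
  have "d x b \<le> gdist ?H x b"
    by (rule H.potential_le_dist[where f = "\<lambda>x. d x b"]) (use lip V x in auto)
  then show "gdist ?H x b = d x b" using dist_add_edges_le[OF S x V(2)] by simp
  let ?f = "\<lambda>x. min (d x a) (d x b)"
  \<comment> \<open>On the new edge, \<open>?f\<close> is 0 at \<open>a\<close> and at most 1 at
    \<open>u\<close>.\<close>
  have lip': "?f z \<le> ?f y + 1" if "{y, z} \<in> edges ?H" for y z
  proof (cases "{y, z} \<in> edges G")
    case True
    then show ?thesis using dist_edge[of y z a] dist_edge[of y z b] V by auto
  next
    case False
    then have "{y, z} = {a, u}" using that by simp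
    then show ?thesis using 1 by (auto simp: doubleton_eq_iff)
  qed
  show "?f x \<le> gdist ?H x a"
    by (rule H.potential_le_dist[where f = ?f]) (use lip' V x in auto)
qed

text \<open>If the old ratio is bad, almost all vertices are closer to \<open>b\<close>; those closer to \<open>a\<close>, the only
  ones that can make \<open>C(a)\<close> smaller than \<open>C(b)\<close>, are then too few for the new ratio to be bad.\<close>

lemma extend_ratio:
  assumes ab: "{a, b} \<in> edges G" and u: "{b, u} \<in> edges G" "{a, u} \<notin> edges G" "u \<noteq> a"
    and less: "total_dist G b < total_dist G a"
    and le: "total_dist (add_edges G {{a, u}}) a \<le> total_dist (add_edges G {{a, u}}) b"
  shows "6 / 11 \<le> closeness_ratio G a b \<or> 6 / 11 \<le> closeness_ratio (add_edges G {{a, u}}) a b"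
proof -
  define H where "H = add_edges G {{a, u}}"
  have V: "a \<in> V" "b \<in> V" "u \<in> V" and ne: "a \<noteq> b" using edge_verts ab u by blast+
  interpret H: conn_graph H unfolding H_def
    by (rule conn_graph_add_edges) (use V u in \<open>simp add: vpairs_iff\<close>)
  have vH: "verts H = V" by (simp add: H_def)
  define W where "W = V - {a, b}"
  have W: "x \<in> V" "0 < d x a" "0 < d x b" "0 < gdist H x a" if "x \<in> W" for x
    using that V vH H.dist_0_iff[of x a] by (auto simp: W_def intro!: gr0I)
  have 1: "d a b = 1" "d b a = 1" using dist_edge_1 ab by (simp_all add: insert_commute)
  have H1: "gdist H b a = 1" using H.dist_edge_1[of b a] ab by (simp add: H_def insert_commute)
  have lip: "d x a \<le> d x b + 1" "d x b \<le> d x a + 1" if "x \<in> V" for x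
    using dist_triangle[of x a b] dist_triangle[of x b a] 1 that V by auto
  define ip iq where "ip x = (if d x a < d x b then 1 else 0 :: int)"
    and "iq x = (if d x b < d x a then 1 else 0 :: int)" for x
  define p q where "p = sum ip W" and "q = sum iq W"
  define A B A' where "A = int (total_dist G a)" and "B = int (total_dist G b)"
    and "A' = int (total_dist H a)"
  have nn: "0 \<le> p" "0 \<le> q" by (auto simp: p_def q_def ip_def iq_def intro!: sum_nonneg)
  have B': "total_dist H b = total_dist G b"
    using dist_star_edge_b(1)[OF ab u] by (simp add: total_dist_def H_def)
  have AW: "A = 1 + (\<Sum>x\<in>W. int (d x a))"
    using sum_split2[OF V(1,2) ne, of "\<lambda>x. int (d x a)"] 1 by (simp add: A_def W_def total_dist_def)
  have BW: "B = 1 + (\<Sum>x\<in>W. int (d x b))"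
    using sum_split2[OF V(1,2) ne, of "\<lambda>x. int (d x b)"] 1 by (simp add: B_def W_def total_dist_def)
  have A'W: "A' = 1 + (\<Sum>x\<in>W. int (gdist H x a))"
    using sum_split2[OF V(1,2) ne, of "\<lambda>x. int (gdist H x a)"] H1
    by (simp add: A'_def W_def total_dist_def vH)
  have "A - B = (\<Sum>x\<in>W. int (d x a) - int (d x b))" by (simp add: AW BW sum_subtractf)
  also have "\<dots> = (\<Sum>x\<in>W. iq x - ip x)"
    by (rule sum.cong) (use lip W in \<open>force simp: ip_def iq_def\<close>)+
  finally have diff: "A - B = q - p" by (simp add: sum_subtractf p_def q_def)
  \<comment> \<open>Only a vertex closer to \<open>a\<close> can be nearer to \<open>a\<close> in
    \<open>H\<close> than it is to \<open>b\<close>, and only by one.\<close>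
  have "(\<Sum>x\<in>W. int (d x b) - ip x) \<le> (\<Sum>x\<in>W. int (gdist H x a))"
  proof (rule sum_mono)
    fix x assume x: "x \<in> W"
    have "min (d x a) (d x b) \<le> gdist H x a"
      using dist_star_edge_b(2)[OF ab u W(1)[OF x]] by (simp add: H_def)
    then show "int (d x b) - ip x \<le> int (gdist H x a)"
      using lip[OF W(1)[OF x]] by (auto simp: ip_def)
  qed
  then have A'B: "B - p \<le> A'" by (simp add: BW A'W sum_subtractf p_def)
  have "(\<Sum>x\<in>W. 2 * ip x + iq x) \<le> (\<Sum>x\<in>W. int (d x b))"
    by (rule sum_mono) (use W in \<open>force simp: ip_def iq_def\<close>)
  then have B1: "1 + 2 * p + q \<le> B" by (simp add: BW p_def q_def sum.distrib sum_distrib_left)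
  have "(\<Sum>x\<in>W. ip x + iq x) \<le> (\<Sum>x\<in>W. int (gdist H x a))"
    by (rule sum_mono) (use W in \<open>force simp: ip_def iq_def\<close>)
  then have A'1: "1 + p + q \<le> A'" by (simp add: A'W p_def q_def sum.distrib)
  \<comment> \<open>If both fail, the first gives \<open>5 B < 6 (q - p)\<close>, hence
    \<open>q > 16 p\<close> by the lower bound on \<open>B\<close>. The second, with
    \<open>B \<le> A' + p\<close>, gives \<open>5 A' < 6 p\<close>, hence \<open>p > 5 q\<close>.
    These exclude each other.\<close>
  have "6 * A \<le> 11 * B \<or> 6 * B \<le> 11 * A'" using diff A'B B1 A'1 nn by linarith
  moreover have "0 < A" "0 < B" using less B1 nn by (auto simp: A_def)
  ultimately show ?thesis using less le B'
    by (auto simp: closeness_ratio_def A_def A'_def B_def min_def max_def field_simps simp flip: H_def)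
qed

section \<open>The degree of \<open>a\<close> and an exhausted budget\<close>

lemma card_nbrs_le_total_dist:
  assumes a: "a \<in> V"
  shows "2 * (card V - 1) \<le> total_dist G a + card (nbrs G a)"
proof -
  have N: "nbrs G a \<subseteq> V - {a}" using edge_verts by (auto simp: nbrs_def)
  have "2 * (card V - 1) = (\<Sum>x\<in>V - {a}. 2)" using a by simp
  \<comment> \<open>Distance 1 occurs only at neighbours; every other vertex is at distance at least
    2.\<close>
  also have "\<dots> \<le> (\<Sum>x\<in>V - {a}. d x a + (if x \<in> nbrs G a then 1 else 0))"
  proof (rule sum_mono)
    fix x assume x: "x \<in> V - {a}"
    then have "d x a \<noteq> 0" using a by auto
    then have "2 \<le> d x a \<or> d x a = 1" by linarith
    then show "2 \<le> d x a + (if x \<in> nbrs G a then 1 else 0)"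
      using x a dist_1_iff[of x a] by (auto simp: nbrs_def insert_commute)
  qed
  also have "\<dots> = (\<Sum>x\<in>V - {a}. d x a) + card ((V - {a}) \<inter> nbrs G a)"
    by (simp add: sum.distrib sum.If_cases Int_def)
  also have "(V - {a}) \<inter> nbrs G a = nbrs G a" using N by blast
  also have "(\<Sum>x\<in>V - {a}. d x a) = total_dist G a"
    using a by (simp add: total_dist_def sum.remove[of V a])
  finally show ?thesis .
qed

lemma card_nbrs_add_edges_le:
  assumes "finite T"
  shows "card (nbrs (add_edges G T) a) \<le> card (nbrs G a) + card T"
proof -
  have fin: "finite (nbrs G a)" using edge_verts by (auto simp: nbrs_def intro: finite_subset[of _ V])
  have sub: "(\<lambda>y. {a, y}) ` {y. {a, y} \<in> T} \<subseteq> T" by auto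
  have inj: "inj_on (\<lambda>y. {a, y}) X" for X by (auto simp: inj_on_def doubleton_eq_iff)
  have "finite {y. {a, y} \<in> T}" "card {y. {a, y} \<in> T} \<le> card T"
    using finite_subset[OF sub assms] finite_imageD[OF _ inj] card_inj_on_le[OF inj sub assms] by blast+
  moreover have "nbrs (add_edges G T) a = nbrs G a \<union> {y. {a, y} \<in> T}" by (auto simp: nbrs_def)
  ultimately show ?thesis using card_Un_le[of "nbrs G a" "{y. {a, y} \<in> T}"] by simp
qed

text \<open>The shape of the set \<open>S\<close> whenever the loop condition is tested.\<close>

definition star :: "'a \<Rightarrow> 'a \<Rightarrow> 'a set set \<Rightarrow> bool" where
  "star a b S \<longleftrightarrow> S \<subseteq> non_edges G \<and> {a, b} \<in> edges G \<union> S \<and>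
     (\<forall>e\<in>S. \<exists>u. e = {a, u} \<and> (u = b \<or> {b, u} \<in> edges G))"

lemma non_edges_vpairs: "S \<subseteq> non_edges G \<Longrightarrow> S \<subseteq> vpairs V"
  by (auto simp: non_edges_def)

lemma finite_non_edges: "S \<subseteq> non_edges G \<Longrightarrow> finite S"
  by (rule finite_subset[OF non_edges_vpairs finite_vpairs]) auto

text \<open>Every edge of a star contains \<open>a\<close>, so none is wasted: the degree bound for
  arbitrary edge sets is attained.\<close>

lemma card_nbrs_star:
  assumes "star a b S"
  shows "card (nbrs (add_edges G S) a) = card (nbrs G a) + card S"
proof -
  have S: "S \<subseteq> non_edges G" using assms by (simp add: star_def)
  have fin: "finite (nbrs G a)" using edge_verts by (auto simp: nbrs_def intro: finite_subset[of _ V])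
  have inj: "inj_on (\<lambda>y. {a, y}) X" for X by (auto simp: inj_on_def doubleton_eq_iff)
  have S': "S = (\<lambda>y. {a, y}) ` {y. {a, y} \<in> S}" using assms by (force simp: star_def)
  then have fin': "finite {y. {a, y} \<in> S}" using finite_imageD[OF _ inj] finite_non_edges[OF S] by metis
  have "nbrs (add_edges G S) a = nbrs G a \<union> {y. {a, y} \<in> S}" by (auto simp: nbrs_def)
  moreover have "nbrs G a \<inter> {y. {a, y} \<in> S} = {}" using S by (auto simp: nbrs_def non_edges_def)
  moreover have "card S = card {y. {a, y} \<in> S}" using S' card_image[OF inj] by metis
  ultimately show ?thesis using card_Un_disjoint[OF fin fin'] by simp
qed

text \<open>The star edges other than \<open>ab\<close> join \<open>a\<close> to neighbours of
  \<open>b\<close>, so only the passage through \<open>ab\<close> can shorten a path to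
  \<open>b\<close>. A path to \<open>a\<close> that ends in a new edge has come within distance one
  of \<open>b\<close> before that edge, which gives the second bound.\<close>

lemma dist_star:
  assumes ab: "a \<in> V" "b \<in> V" and S: "star a b S" and x: "x \<in> V"
  shows "gdist (add_edges G S) x b = min (d x b) (d x a + 1)"
    and "min (d x a) (gdist (add_edges G S) x b) \<le> gdist (add_edges G S) x a"
proof -
  let ?H = "add_edges G S"
  have Sv: "S \<subseteq> vpairs V" using S by (auto simp: star_def non_edges_def)
  interpret H: conn_graph ?H by (rule conn_graph_add_edges) fact
  have edge: "{y, z} \<in> edges G \<or> (y = a \<and> (z = b \<or> {b, z} \<in> edges G)) \<or> (z = a \<and> (y = b \<or> {b, y} \<in> edges G))"
    if "{y, z} \<in> edges ?H" for y z
    using that S by (fastforce simp: star_def doubleton_eq_iff)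
  have 1: "gdist ?H a b = 1" using S by (intro H.dist_edge_1) (simp add: star_def)
  have ab_le: "d z b \<le> 1" if "z = b \<or> {b, z} \<in> edges G" for z
    using that dist_edge_1[of z b] by (auto simp: insert_commute)
  let ?f = "\<lambda>x. min (d x b) (d x a + 1)"
  show eq: "gdist ?H x b = ?f x"
  proof (rule antisym)
    have "gdist ?H x b \<le> gdist ?H x a + gdist ?H a b" using H.dist_triangle[of x a b] ab x by simp
    then show "gdist ?H x b \<le> ?f x"
      using dist_add_edges_le[OF Sv x ab(1)] dist_add_edges_le[OF Sv x ab(2)] 1 by simp
    have lip: "?f z \<le> ?f y + 1" if "{y, z} \<in> edges ?H" for y z
      using edge[OF that]
    proof (elim disjE)
      assume "{y, z} \<in> edges G"
      then show ?thesis using dist_edge[of y z a] dist_edge[of y z b] ab by auto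
    qed (use ab_le[of y] ab_le[of z] in \<open>auto simp: min_def\<close>)
    show "?f x \<le> gdist ?H x b"
      by (rule H.potential_le_dist[where f = ?f]) (use lip ab x in auto)
  qed
  let ?g = "\<lambda>x. min (d x a) (gdist ?H x b)"
  have Hle: "gdist ?H z b \<le> 1" if "z = b \<or> {b, z} \<in> edges G" for z
    using that H.dist_edge_1[of z b] by (auto simp: insert_commute)
  have lip: "?g z \<le> ?g y + 1" if "{y, z} \<in> edges ?H" for y z
  proof (cases "{y, z} \<in> edges G")
    case True
    then show ?thesis using dist_edge[of y z a] H.dist_edge[of y z b] ab that by auto
  next
    case False
    then show ?thesis using edge[OF that] Hle[of y] Hle[of z] by (auto simp: min_def)
  qed
  show "?g x \<le> gdist ?H x a"
    by (rule H.potential_le_dist[where f = ?g]) (use lip ab x in auto)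
qed

text \<open>If the ratio for \<open>S\<close> is below \<open>6/11\<close>, then most vertices are adjacent to \<open>b\<close> but not to
  \<open>a\<close>. With \<open>k\<close> edges no solution gives \<open>a\<close> more neighbours than \<open>S\<close> does, and keeping \<open>a\<close> far
  from \<open>b\<close> keeps it far from all neighbours of \<open>b\<close>; hence no solution has a ratio above \<open>11/12\<close>.\<close>

lemma finish_ratio:
  assumes ab: "a \<in> V" "b \<in> V" "a \<noteq> b" and S: "star a b S" and T: "T \<subseteq> non_edges G" "card T \<le> card S"
    and less: "total_dist (add_edges G S) b < total_dist (add_edges G S) a"
  shows "6 / 11 * closeness_ratio (add_edges G T) a b \<le> closeness_ratio (add_edges G S) a b"
proof -
  define H K where "H = add_edges G S" and "K = add_edges G T"
  have Sv: "S \<subseteq> vpairs V" and Tv: "T \<subseteq> vpairs V" using S T by (auto simp: star_def non_edges_def)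
  interpret H: conn_graph H unfolding H_def by (rule conn_graph_add_edges) fact
  interpret K: conn_graph K unfolding K_def by (rule conn_graph_add_edges) fact
  have v: "verts H = V" "verts K = V" by (simp_all add: H_def K_def)
  have abH: "{a, b} \<in> edges H" using S by (simp add: H_def star_def)
  define W where "W = V - {a, b}"
  have W: "x \<in> V" "x \<noteq> a" "x \<noteq> b" "0 < gdist H x a" "0 < gdist H x b" if "x \<in> W" for x
    using that ab v H.dist_0_iff[of x a] H.dist_0_iff[of x b] by (auto simp: W_def intro!: gr0I)
  have 1: "gdist H a b = 1" "gdist H b a = 1" using H.dist_edge_1 abH by (simp_all add: insert_commute)
  have lip: "gdist H x a \<le> gdist H x b + 1" "gdist H x b \<le> gdist H x a + 1" if "x \<in> V" for x
    using H.dist_triangle[of x a b] H.dist_triangle[of x b a] 1 that ab v by auto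
  \<comment> \<open>The vertices closer to \<open>b\<close> are split: those counted by
    \<open>q\<close> are adjacent to \<open>b\<close> in \<open>H\<close>, those counted by
    \<open>q'\<close> are at distance at least 2 from it.\<close>
  define ip iq jq ir where "ip x = (if gdist H x a < gdist H x b then 1 else 0 :: int)"
    and "iq x = (if gdist H x b < gdist H x a \<and> gdist H x b = 1 then 1 else 0 :: int)"
    and "jq x = (if gdist H x b < gdist H x a \<and> gdist H x b \<noteq> 1 then 1 else 0 :: int)"
    and "ir x = (if gdist H x b = gdist H x a then 1 else 0 :: int)" for x
  note idefs = ip_def iq_def jq_def ir_def
  define p q q' r where "p = sum ip W" and "q = sum iq W" and "q' = sum jq W" and "r = sum ir W"
  note defs = p_def q_def q'_def r_def
  define A B A' B' where "A = int (total_dist H a)" and "B = int (total_dist H b)"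
    and "A' = int (total_dist K a)" and "B' = int (total_dist K b)"
  \<comment> \<open>The excess of the distance of \<open>a\<close> and \<open>b\<close> in the
    competing graph \<open>K\<close> over their distance 1 in \<open>H\<close>.\<close>
  define e where "e = int (gdist K a b) - 1"
  have nn: "0 \<le> p" "0 \<le> q" "0 \<le> q'" "0 \<le> r" by (auto simp: defs idefs intro!: sum_nonneg)
  have e0: "0 \<le> e" using K.dist_0_iff[of a b] ab v by (simp add: e_def Suc_le_eq del: K.dist_0_iff)
  have AW: "A = 1 + (\<Sum>x\<in>W. int (gdist H x a))"
    using sum_split2[OF ab, of "\<lambda>x. int (gdist H x a)"] 1 by (simp add: A_def W_def total_dist_def v)
  have BW: "B = 1 + (\<Sum>x\<in>W. int (gdist H x b))"
    using sum_split2[OF ab, of "\<lambda>x. int (gdist H x b)"] 1 by (simp add: B_def W_def total_dist_def v)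
  have A'W: "A' = 1 + e + (\<Sum>x\<in>W. int (gdist K x a))"
    using sum_split2[OF ab, of "\<lambda>x. int (gdist K x a)"] K.dist_sym[of a b]
    by (simp add: A'_def W_def total_dist_def v e_def)
  have B'W: "B' = 1 + e + (\<Sum>x\<in>W. int (gdist K x b))"
    using sum_split2[OF ab, of "\<lambda>x. int (gdist K x b)"]
    by (simp add: B'_def W_def total_dist_def v e_def)
  have "A - B = (\<Sum>x\<in>W. int (gdist H x a) - int (gdist H x b))" by (simp add: AW BW sum_subtractf)
  also have "\<dots> = (\<Sum>x\<in>W. iq x + jq x - ip x)"
    by (rule sum.cong) (use lip W in \<open>force simp: idefs\<close>)+
  finally have diff: "A - B = q + q' - p" by (simp add: sum_subtractf sum.distrib defs)
  have "(\<Sum>x\<in>W. iq x + 2 * jq x + ir x + 2 * ip x) \<le> (\<Sum>x\<in>W. int (gdist H x b))"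
    by (rule sum_mono) (use W in \<open>force simp: idefs\<close>)
  then have B1: "1 + q + 2 * q' + r + 2 * p \<le> B" by (simp add: BW defs sum.distrib sum_distrib_left)
  \<comment> \<open>If passing through \<open>ab\<close> had shortened the distance to
    \<open>b\<close>, then \<open>x\<close> would be closer to \<open>a\<close>. So this is still
    the distance in \<open>G\<close>, which \<open>K\<close> can only reduce.\<close>
  have far: "gdist K x b \<le> gdist H x b" if "x \<in> V" "\<not> gdist H x a < gdist H x b" for x
    using dist_star(1)[OF ab(1,2) S, of x] that dist_add_edges_le[OF Sv, of x a] dist_add_edges_le[OF Tv, of x b] ab
    by (auto simp: H_def K_def)
  \<comment> \<open>The distance of \<open>x\<close> to \<open>a\<close> is the same in
    \<open>H\<close> as in \<open>G\<close>, so it is no larger in \<open>K\<close>; going on to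
    \<open>b\<close> costs \<open>1 + e\<close>.\<close>
  have near: "int (gdist K x b) \<le> int (gdist H x b) + e" if "x \<in> V" "gdist H x a < gdist H x b" for x
    using dist_star(2)[OF ab(1,2) S, of x] that dist_add_edges_le[OF Tv, of x a] ab
      K.dist_triangle[of x a b] v by (auto simp: H_def K_def e_def)
  have "(\<Sum>x\<in>W. int (gdist K x b)) \<le> (\<Sum>x\<in>W. int (gdist H x b) + e * ip x)"
    by (rule sum_mono) (use far near W in \<open>force simp: ip_def\<close>)
  \<comment> \<open>The extra 1 in \<open>p + 1\<close> is the vertex \<open>a\<close>
    itself.\<close>
  then have B'le: "B' \<le> B + (p + 1) * e"
    by (simp add: BW B'W sum.distrib p_def sum_distrib_left algebra_simps)
  \<comment> \<open>A vertex counted by \<open>q\<close> stays within distance 1 of \<open>b\<close>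
    in \<open>K\<close>, hence is at distance at least \<open>e\<close> from
    \<open>a\<close>.\<close>
  have "(\<Sum>x\<in>W. iq x * e) \<le> (\<Sum>x\<in>W. int (gdist K x a))"
  proof (rule sum_mono)
    fix x assume x: "x \<in> W"
    show "iq x * e \<le> int (gdist K x a)"
    proof (cases "iq x = 0")
      case False
      then have "gdist K x b \<le> 1" using far[OF W(1)[OF x]] by (auto simp: iq_def split: if_splits)
      then have "e \<le> int (gdist K x a)"
        using K.dist_triangle[of a x b] K.dist_sym[of a x] W(1)[OF x] ab v by (auto simp: e_def)
      then show ?thesis by (simp add: iq_def)
    qed simp
  qed
  then have A'q: "q * e \<le> A'" using e0 by (simp add: A'W q_def sum_distrib_right)
  have fW: "finite W" by (simp add: W_def)
  \<comment> \<open>The neighbours of \<open>a\<close> in \<open>H\<close> other than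
    \<open>b\<close> are all counted by \<open>p\<close> or \<open>r\<close>. This caps the degree
    of \<open>a\<close> in \<open>K\<close> too and thereby makes \<open>A'\<close> large.\<close>
  have "card (nbrs H a) \<le> card (insert b {x \<in> W. \<not> gdist H x b < gdist H x a})"
  proof (rule card_mono)
    show "nbrs H a \<subseteq> insert b {x \<in> W. \<not> gdist H x b < gdist H x a}"
    proof
      fix x assume "x \<in> nbrs H a"
      then have "{a, x} \<in> edges H" by (simp add: nbrs_def)
      then have x: "x \<in> V" "x \<noteq> a" "gdist H x a = 1"
        using H.edge_verts H.dist_edge_1[of x a] v by (auto simp: insert_commute)
      then show "x \<in> insert b {x \<in> W. \<not> gdist H x b < gdist H x a}"
        using W(5)[of x] by (force simp: W_def)
    qed
  qed (use fW in simp)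
  also have "\<dots> \<le> Suc (card {x \<in> W. \<not> gdist H x b < gdist H x a})" by (rule card_insert_le_m1) auto
  also have "int \<dots> = 1 + (\<Sum>x\<in>W. if \<not> gdist H x b < gdist H x a then 1 else 0)"
    using fW by (simp add: sum.If_cases Int_def)
  also have "(\<Sum>x\<in>W. if \<not> gdist H x b < gdist H x a then 1 else 0) = (\<Sum>x\<in>W. ip x + ir x)"
    by (rule sum.cong) (auto simp: idefs)
  finally have deg: "int (card (nbrs H a)) \<le> 1 + p + r" by (simp add: sum.distrib defs)
  have "int (card W) = (\<Sum>x\<in>W. 1)" by simp
  also have "\<dots> = (\<Sum>x\<in>W. ip x + iq x + jq x + ir x)" by (rule sum.cong) (auto simp: idefs)
  finally have cW: "int (card W) = p + q + q' + r" by (simp add: sum.distrib defs)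
  have "card V - 1 = card W + 1"
    using ab sum_split2[OF ab, of "\<lambda>_. 1::nat"] by (simp add: W_def)
  then have "2 * (card W + 1) \<le> total_dist K a + card (nbrs K a)"
    using K.card_nbrs_le_total_dist[of a] ab v by simp
  also have "card (nbrs K a) \<le> card (nbrs H a)"
    using card_nbrs_add_edges_le[OF finite_non_edges[OF T(1)], of a] card_nbrs_star[OF S] T(2)
    by (simp add: H_def K_def)
  finally have "2 * (int (card W) + 1) \<le> A' + int (card (nbrs H a))" by (simp add: A'_def)
  then have A'1: "2 * q + 2 * q' + p + r + 1 \<le> A'" using cW deg by simp
  have Bpos: "0 < B" using B1 nn by linarith
  have A'pos: "0 < A'" using A'1 nn by linarith
  have AB: "B < A" using less by (simp add: A_def B_def H_def)
  have RS: "closeness_ratio H a b = real_of_int B / real_of_int A"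
    using AB by (simp add: closeness_ratio_def A_def B_def min_def max_def)
  have RT: "closeness_ratio K a b \<le> 1" by (rule K.ratio_bounds)
  show ?thesis
  proof (cases "6 * A \<le> 11 * B")
    case True
    then have "6 / 11 \<le> closeness_ratio H a b" unfolding RS using Bpos AB by (simp add: field_simps)
    then show ?thesis using RT by (simp add: H_def K_def)
  next
    case False
    then have bad: "5 * B + 6 * p < 6 * q + 6 * q'" using diff by simp
    \<comment> \<open>Inserting the lower bound on \<open>B\<close> into \<open>bad\<close> even
      gives \<open>q > 5 + 16 p\<close>.\<close>
    have "5 * (p + 1) \<le> q" using bad B1 nn by simp
    then have "(5 * (p + 1)) * e \<le> q * e" using e0 by (rule mult_right_mono)
    then have pe: "5 * ((p + 1) * e) \<le> q * e" by (simp add: algebra_simps)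
    define X Y where "X = (p + 1) * e" and "Y = q * e"
    \<comment> \<open>From \<open>5 B < 6 (q + q') \<le> 3 A'\<close> and
      \<open>5 X \<le> Y \<le> A'\<close> one gets \<open>B' < 4/5 A'\<close>. The weaker 11/12
      suffices: 6/11 of it is 1/2, and the ratio for \<open>S\<close> is at least 1/2 since
      \<open>A - B \<le> q + q' \<le> B\<close>.\<close>
    have "12 * B' \<le> 11 * A'"
      using bad B1 nn B'le A'q A'1 pe unfolding X_def[symmetric] Y_def[symmetric] by linarith
    then have "closeness_ratio K a b \<le> 11 / 12"
      using A'pos by (auto simp: closeness_ratio_def A'_def B'_def min_def max_def field_simps)
    moreover have "1 / 2 \<le> closeness_ratio H a b"
      unfolding RS using Bpos AB diff B1 nn by (simp add: field_simps)
    ultimately show ?thesis by (simp add: H_def K_def)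
  qed
qed

text \<open>For \<open>x\<close> other than \<open>a\<close> and \<open>b\<close>, a shortest path
  from \<open>b\<close> to \<open>x\<close> starts with a vertex of the closed neighbourhood of
  \<open>a\<close>, so \<open>a\<close> is no farther from \<open>x\<close>. By contraposition there
  is a vertex to choose as long as \<open>C(b) < C(a)\<close>.\<close>

lemma total_dist_le_if_nbrs_subset:
  assumes ab: "{a, b} \<in> edges G" and sub: "nbrs G b \<subseteq> closed_nbrs G a"
  shows "total_dist G a \<le> total_dist G b"
proof -
  have V: "a \<in> V" "b \<in> V" and ne: "a \<noteq> b" using edge_verts ab by blast+
  have "d x a \<le> d x b" if x: "x \<in> V - {a, b}" for x
  proof -
    obtain l where l: "d b x = Suc l" using x V by (cases "d b x") auto
    with x V obtain w where w: "{b, w} \<in> edges G" "w \<in> V" "d w x = l"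
      using dist_pred[of b x l] by blast
    then have "w = a \<or> {w, a} \<in> edges G" using sub by (auto simp: nbrs_def closed_nbrs_def insert_commute)
    then have "d a x \<le> Suc l" using w dist_edge[of w a x] x by auto
    then show ?thesis using l dist_sym by metis
  qed
  then have "(\<Sum>x\<in>V - {a, b}. d x a) \<le> (\<Sum>x\<in>V - {a, b}. d x b)" by (rule sum_mono)
  then show ?thesis
    using sum_split2[OF V ne, of "\<lambda>x. d x a"] sum_split2[OF V ne, of "\<lambda>x. d x b"] dist_sym[of a b]
    by (simp add: total_dist_def)
qed

end

section \<open>Runs of the algorithm: invariant, termination, approximation\<close>

lemma larger_ratioD:
  assumes "larger_ratio G a b S T X"
  shows "X = S \<or> X = T"
    and "closeness_ratio (add_edges G S) a b \<le> closeness_ratio (add_edges G X) a b"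
    and "closeness_ratio (add_edges G T) a b \<le> closeness_ratio (add_edges G X) a b"
  using assms by (auto simp: larger_ratio_def)

lemma larger_ratio_ex: "\<exists>X. larger_ratio G a b S T X"
  unfolding larger_ratio_def
  using linear[of "closeness_ratio (add_edges G T) a b" "closeness_ratio (add_edges G S) a b"] by blast

locale alg_instance =
  fixes G :: "'a ugraph" and a b :: 'a and k :: nat
  assumes input: "alg_input G a b k"
begin

sublocale conn_graph G
  using input by unfold_locales (auto simp: alg_input_def)

lemma ab: "a \<in> V" "b \<in> V" "a \<noteq> b" and k: "0 < k" and less: "total_dist G b < total_dist G a"
  using input by (auto simp: alg_input_def)

abbreviation ratio :: "'a set set \<Rightarrow> real" where "ratio S \<equiv> closeness_ratio (add_edges G S) a b"

definition good :: "'a set set \<Rightarrow> bool" where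
  "good X \<longleftrightarrow> X \<subseteq> non_edges G \<and> card X \<le> k \<and> (\<forall>T\<in>feasible G k. 6 / 11 * ratio T \<le> ratio X)"

fun config_inv :: "'a config \<Rightarrow> bool" where
  "config_inv Start \<longleftrightarrow> True"
| "config_inv (Loop S) \<longleftrightarrow> star a b S \<and> card S \<le> k \<and>
     total_dist (add_edges G S) b < total_dist (add_edges G S) a"
| "config_inv (Return X) \<longleftrightarrow> good X"

text \<open>A termination measure. \<open>Start\<close> lies above \<open>Loop {}\<close>, which has
  rank \<open>k + 1\<close>; a loop with exhausted budget still has rank 1.\<close>

fun rank :: "'a config \<Rightarrow> nat" where
  "rank Start = k + 2"
| "rank (Loop S) = Suc k - card S"
| "rank (Return X) = 0"

text \<open>No ratio exceeds 1, so the absolute bound 6/11 suffices. Only the exhausted budget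
  requires a comparison with other solutions.\<close>

lemma goodI:
  assumes "X \<subseteq> non_edges G" "card X \<le> k" "6 / 11 \<le> ratio X"
  shows "good X"
proof -
  have "6 / 11 * ratio T \<le> ratio X" if "T \<in> feasible G k" for T
  proof -
    have "ratio T \<le> 1"
      using that conn_graph.ratio_bounds[OF conn_graph_add_edges[OF non_edges_vpairs]]
      by (auto simp: feasible_def)
    then show ?thesis using assms by linarith
  qed
  then show ?thesis using assms by (simp add: good_def)
qed

text \<open>All edges of \<open>S\<close> contain \<open>a\<close>, so \<open>bu\<close> is none of
  them: the chosen \<open>u\<close> is a neighbour of \<open>b\<close> already in \<open>G\<close>,
  which preserves the star shape.\<close>

lemma extend_star:
  assumes S: "star a b S" and u: "u \<in> nbrs (add_edges G S) b - closed_nbrs (add_edges G S) a"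
  shows "{a, u} \<notin> edges G \<union> S" "u \<noteq> a" "{b, u} \<in> edges G" "star a b (S \<union> {{a, u}})"
    "card (S \<union> {{a, u}}) = Suc (card S)"
proof -
  show 1: "{a, u} \<notin> edges G \<union> S" "u \<noteq> a" using u by (auto simp: closed_nbrs_def nbrs_def)
  have "{b, u} \<in> edges G \<union> S" using u by (auto simp: nbrs_def)
  moreover have "{b, u} \<notin> S" using S 1 ab by (fastforce simp: star_def doubleton_eq_iff)
  ultimately show 2: "{b, u} \<in> edges G" by simp
  then have "u \<in> V" using edge_verts by blast
  then have "{a, u} \<in> non_edges G" using 1 ab by (auto simp: non_edges_def vpairs_iff)
  then show "star a b (S \<union> {{a, u}})" using S 2 by (auto simp: star_def)
  show "card (S \<union> {{a, u}}) = Suc (card S)"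
    using 1 finite_non_edges[of S] S by (simp add: star_def)
qed

lemma star_join: "{a, b} \<notin> edges G \<Longrightarrow> star a b {{a, b}}"
  using ab by (auto simp: star_def non_edges_def vpairs_iff)

lemma config_inv_step:
  assumes "alg_step G a b k c c'" "config_inv c"
  shows "config_inv c' \<and> rank c' < rank c"
  using assms
proof (cases rule: alg_step.cases)
  case adjacent
  then show ?thesis using less k by (simp add: star_def)
next
  case (join S)
  then show ?thesis using star_join k by simp
next
  case (join_return S X)
  then have "6 / 11 \<le> ratio {{a, b}}" using join_ratio ab less by blast
  then have "6 / 11 \<le> ratio X" using larger_ratioD(2)[OF join_return(6)] join_return by simp
  moreover have "X \<subseteq> non_edges G" "card X \<le> k"
    using larger_ratioD(1)[OF join_return(6)] join_return star_join k by (auto simp: star_def)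
  ultimately show ?thesis using join_return by (simp add: goodI)
next
  case (extend S u S')
  then show ?thesis using extend_star[of S u] assms(2) by simp
next
  case (extend_return S u S' X)
  then have S: "star a b S" and less': "total_dist (add_edges G S) b < total_dist (add_edges G S) a"
    using assms(2) by auto
  note u = extend_star[OF S extend_return(4)]
  interpret H: conn_graph "add_edges G S"
    using S by (intro conn_graph_add_edges non_edges_vpairs) (simp add: star_def)
  \<comment> \<open>The bound for a single added edge is applied to \<open>G + S\<close>, where
    \<open>a\<close> and \<open>b\<close> are adjacent.\<close>
  have "6 / 11 \<le> ratio S \<or> 6 / 11 \<le> ratio S'"
    using H.extend_ratio[of a b u] S u less' extend_return by (auto simp: star_def)
  moreover have "S' - {{a, u}} = S" using u extend_return by auto
  ultimately have "6 / 11 \<le> ratio X" and X: "X = S \<or> X = S'"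
    using larger_ratioD[OF extend_return(7)] by auto
  moreover have "X \<subseteq> non_edges G" "card X \<le> k"
    using X S u extend_return by (auto simp: star_def)
  ultimately show ?thesis using extend_return assms(2) by (simp add: goodI less_Suc_eq_le)
next
  case (finish S X)
  then have S: "star a b S" "card S = k" and less': "total_dist (add_edges G S) b < total_dist (add_edges G S) a"
    using assms(2) by auto
  have "6 / 11 * ratio T \<le> ratio X" if "T \<in> feasible G k" for T
    using finish_ratio[OF ab S(1) _ _ less', of T] that S larger_ratioD(2)[OF finish(4)]
    by (auto simp: feasible_def)
  moreover have "X \<subseteq> non_edges G" "card X \<le> k"
    using S larger_ratioD(1)[OF finish(4)] by (auto simp: star_def)
  ultimately show ?thesis using finish S by (simp add: good_def)
qed

lemma config_inv_steps: "alg_steps G a b k Start c \<Longrightarrow> config_inv c"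
  by (induction rule: rtranclp_induct) (use config_inv_step in auto)

lemma terminates: "alg_terminates G a b k"
  unfolding alg_terminates_def
proof safe
  fix f assume f: "f 0 = Start" "\<forall>i. alg_step G a b k (f i) (f (Suc i))"
  have inv: "config_inv (f i)" for i
  proof (induction i)
    case (Suc i)
    then show ?case using config_inv_step f(2) by blast
  qed (simp add: f)
  have "rank (f i) + i \<le> rank (f 0)" for i
  proof (induction i)
    case (Suc i)
    then show ?case using config_inv_step[OF _ inv, of i] f(2) by fastforce
  qed simp
  from this[of "Suc (rank (f 0))"] show False by simp
qed

lemma star_step_ex:
  assumes "star a b S" "total_dist (add_edges G S) b < total_dist (add_edges G S) a"
  shows "\<exists>u. u \<in> nbrs (add_edges G S) b - closed_nbrs (add_edges G S) a"
proof -
  interpret H: conn_graph "add_edges G S"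
    using assms by (intro conn_graph_add_edges non_edges_vpairs) (simp add: star_def)
  show ?thesis using H.total_dist_le_if_nbrs_subset[of a b] assms by (fastforce simp: star_def)
qed

lemma halts_in_Return:
  assumes "alg_halts_in G a b k c"
  shows "\<exists>S. c = Return S \<and> good S"
proof (cases c)
  case Start
  then show ?thesis using assms alg_step.adjacent alg_step.join alg_step.join_return larger_ratio_ex
    unfolding alg_halts_in_def by metis
next
  case (Loop S)
  then have S: "star a b S" "total_dist (add_edges G S) b < total_dist (add_edges G S) a"
    using assms config_inv_steps[of c] by (auto simp: alg_halts_in_def)
  then have "\<exists>c'. alg_step G a b k c c'"
    using star_step_ex[OF S] larger_ratio_ex Loop
      alg_step.extend alg_step.extend_return alg_step.finish by metis
  then show ?thesis using assms by (simp add: alg_halts_in_def)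
next
  case (Return S)
  then show ?thesis using assms config_inv_steps[of c] by (simp add: alg_halts_in_def)
qed

lemma approximation_ratio:
  assumes "good S"
  shows "6 / 11 * opt G a b k \<le> ratio S"
proof -
  have "finite (feasible G k)"
    by (rule finite_subset[of _ "Pow (vpairs V)"]) (auto simp: feasible_def non_edges_def finite_vpairs)
  moreover have "{} \<in> feasible G k" by (simp add: feasible_def)
  ultimately have "opt G a b k \<in> ratio ` feasible G k" unfolding opt_def by (intro Max_in) auto
  then show ?thesis using assms by (auto simp: good_def)
qed

end

section \<open>Totals along an enumeration of the added edges\<close>

text \<open>Lists the vertices that can be joined to \<open>a\<close> in one fixed order, so that
  the sets of a run following it are the prefixes \<open>S i\<close>. Position 0 is \<open>b\<close>
  if \<open>ab\<close> is absent, and \<open>e\<^sub>0\<close> counts this edge.\<close>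

locale star_order = alg_instance G a b k for G :: "'a ugraph" and a b k +
  fixes us :: "nat \<Rightarrow> 'a" and e\<^sub>0 M :: nat
  assumes e0: "e\<^sub>0 = (if {a, b} \<in> edges G then 0 else 1)" and e0_le: "e\<^sub>0 \<le> M"
    and us_0: "{a, b} \<notin> edges G \<Longrightarrow> us 0 = b"
    and bij: "bij_betw us {e\<^sub>0..<M} (nbrs G b - closed_nbrs G a)"
begin

definition S :: "nat \<Rightarrow> 'a set set" where
  "S i = (\<lambda>j. {a, us j}) ` {..<i}"

abbreviation tA where "tA i \<equiv> total_dist (add_edges G (S i)) a"
abbreviation tB where "tB i \<equiv> total_dist (add_edges G (S i)) b"

lemma S_0 [simp]: "S 0 = {}"
  and S_Suc: "S (Suc i) = S i \<union> {{a, us i}}"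
  by (auto simp: S_def lessThan_Suc)

lemma us_nbr: "j < M \<Longrightarrow> e\<^sub>0 \<le> j \<Longrightarrow> {b, us j} \<in> edges G \<and> {a, us j} \<notin> edges G \<and> us j \<noteq> a"
  using bij_betwE[OF bij] by (auto simp: nbrs_def closed_nbrs_def)

lemma us_before: "j < e\<^sub>0 \<Longrightarrow> j = 0 \<and> us j = b \<and> {a, b} \<notin> edges G"
  using us_0 by (auto simp: e0 split: if_splits)

lemma us_in_V: "j < M \<Longrightarrow> us j \<in> V"
  using us_nbr[of j] us_before[of j] edge_verts ab by (cases "e\<^sub>0 \<le> j") auto

lemma us_inj: "inj_on us {..<M}"
proof -
  have "us i \<noteq> us j" if "i < j" "j < M" for i j
  proof (cases "e\<^sub>0 \<le> i")
    case True
    then show ?thesis using inj_onD[OF bij_betw_imp_inj_on[OF bij], of i j] that by auto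
  next
    case False
    then have "us i = b" "e\<^sub>0 \<le> j" using us_before[of i] us_before[of j] that by force+
    then show ?thesis using us_nbr[of j] edge_verts[of b "us j"] that by auto
  qed
  then show ?thesis by (intro inj_onI) (metis lessThan_iff linorder_neqE_nat)
qed

lemma us_eq_iff: "i < M \<Longrightarrow> j < M \<Longrightarrow> us i = us j \<longleftrightarrow> i = j"
  using inj_on_eq_iff[OF us_inj] by simp

lemma S_non_edge: "j < M \<Longrightarrow> {a, us j} \<in> non_edges G"
  using us_nbr[of j] us_before[of j] us_in_V[of j] ab
  by (cases "e\<^sub>0 \<le> j") (auto simp: non_edges_def vpairs_iff)

lemma card_S: "i \<le> M \<Longrightarrow> card (S i) = i"
  unfolding S_def by (subst card_image) (auto simp: doubleton_eq_iff us_eq_iff intro!: inj_onI)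

text \<open>The end points are distinct vertices other than \<open>a\<close>. The strict bound lets
  the number of vertices serve as the rank of what is never reached.\<close>

lemma M_less: "M < card V"
proof -
  have "a \<notin> us ` {..<M}"
    using us_nbr us_before ab by (metis imageE lessThan_iff linorder_not_less)
  then have "us ` {..<M} \<subset> V" using us_in_V ab by auto
  then have "card (us ` {..<M}) < card V" by (rule psubset_card_mono[OF finite_V])
  then show ?thesis using card_image[OF us_inj] by simp
qed

lemma star_S:
  assumes "e\<^sub>0 \<le> i" "i \<le> M"
  shows "star a b (S i)"
  unfolding star_def
proof (intro conjI ballI)
  show "S i \<subseteq> non_edges G" using S_non_edge assms by (auto simp: S_def)
  show "{a, b} \<in> edges G \<union> S i"
    using us_0 assms by (force simp: S_def e0 split: if_splits)
  show "\<exists>u. e = {a, u} \<and> (u = b \<or> {b, u} \<in> edges G)" if e: "e \<in> S i" for e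
  proof -
    obtain j where j: "j < i" "e = {a, us j}" using e by (auto simp: S_def)
    then have "us j = b \<or> {b, us j} \<in> edges G" using us_nbr[of j] us_before[of j] assms by force
    then show ?thesis using j by blast
  qed
qed

lemma us_choice:
  assumes "e\<^sub>0 \<le> i" "i < M"
  shows "us i \<in> nbrs (add_edges G (S i)) b - closed_nbrs (add_edges G (S i)) a"
proof -
  have "{a, us i} \<notin> S i" using assms by (auto simp: S_def doubleton_eq_iff us_eq_iff)
  then show ?thesis using us_nbr[of i] assms by (auto simp: nbrs_def closed_nbrs_def)
qed

text \<open>With all end points joined, the closed neighbourhood of \<open>a\<close> contains every
  neighbour of \<open>b\<close>. So the sign changes at \<open>M\<close> at the latest, whatever the
  budget.\<close>

lemma tA_le_tB_M: "tA M \<le> tB M"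
proof -
  have S: "star a b (S M)" using star_S e0_le by simp
  interpret H: conn_graph "add_edges G (S M)"
    using S by (intro conn_graph_add_edges non_edges_vpairs) (simp add: star_def)
  show ?thesis
  proof (rule H.total_dist_le_if_nbrs_subset)
    show "{a, b} \<in> edges (add_edges G (S M))" using S by (simp add: star_def)
    show "nbrs (add_edges G (S M)) b \<subseteq> closed_nbrs (add_edges G (S M)) a"
    proof
      fix u assume u: "u \<in> nbrs (add_edges G (S M)) b"
      show "u \<in> closed_nbrs (add_edges G (S M)) a"
      proof (rule ccontr)
        assume "u \<notin> closed_nbrs (add_edges G (S M)) a"
        with u extend_star[OF S, of u] have *: "{a, u} \<notin> edges G \<union> S M" "u \<noteq> a" "{b, u} \<in> edges G"
          by auto
        then have "u \<in> nbrs G b - closed_nbrs G a" by (auto simp: nbrs_def closed_nbrs_def)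
        then have "u \<in> us ` {e\<^sub>0..<M}" using bij by (simp add: bij_betw_def)
        then show False using * by (auto simp: S_def)
      qed
    qed
  qed
qed

lemma less_M: "tB i < tA i \<Longrightarrow> i \<le> M \<Longrightarrow> i < M"
  using tA_le_tB_M by (cases "i = M") auto

section \<open>Prefixes of the enumeration as runs\<close>

lemma steps_Loop:
  assumes "e\<^sub>0 \<le> i" "i \<le> k" "i \<le> M" "\<forall>j\<le>i. tB j < tA j"
  shows "alg_steps G a b k Start (Loop (S i))"
  using assms
proof (induction i rule: dec_induct)
  case base
  then have "alg_step G a b k Start (Loop (S e\<^sub>0))"
  proof (cases "{a, b} \<in> edges G")
    case True
    then show ?thesis by (simp add: e0 alg_step.adjacent)
  next
    case False
    then have "S e\<^sub>0 = {{a, b}}" using us_0 by (simp add: e0 S_def lessThan_Suc)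
    moreover have "tB e\<^sub>0 < tA e\<^sub>0" using base by simp
    ultimately show ?thesis using False by (simp add: alg_step.join)
  qed
  then show ?case by (rule r_into_rtranclp)
next
  case (step i)
  have "tB (Suc i) < tA (Suc i)" using step.prems by simp
  then have "alg_step G a b k (Loop (S i)) (Loop (S (Suc i)))"
    using step us_choice[of i] card_S[of i] by (intro alg_step.extend[OF _ _ S_Suc]) auto
  then show ?case using step by (simp add: rtranclp.rtrancl_into_rtrancl)
qed

lemma steps_Return_found:
  assumes i: "Suc i \<le> k" "Suc i \<le> M" "\<forall>j\<le>i. tB j < tA j" "tA (Suc i) \<le> tB (Suc i)"
    and X: "larger_ratio G a b (S (Suc i)) (S i) X"
  shows "alg_steps G a b k Start (Return X)"
proof (cases "e\<^sub>0 \<le> i")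
  case True
  have "S (Suc i) - {{a, us i}} = S i"
    using i(2) by (auto simp: S_Suc S_def doubleton_eq_iff us_eq_iff)
  then have "alg_step G a b k (Loop (S i)) (Return X)"
    using us_choice[of i] card_S[of i] i X True by (intro alg_step.extend_return[OF _ _ S_Suc]) auto
  then show ?thesis using steps_Loop[of i] True i by (simp add: rtranclp.rtrancl_into_rtrancl)
next
  case False
  \<comment> \<open>Here the edge that changes the sign is \<open>ab\<close>, added before the
    loop.\<close>
  then have "i = 0" "us 0 = b" "{a, b} \<notin> edges G" using us_before[of i] by auto
  then have "alg_step G a b k Start (Return X)"
    using i X by (intro alg_step.join_return[of _ _ _ "{{a, b}}"]) (auto simp: S_Suc)
  then show ?thesis by (rule r_into_rtranclp)
qed

lemma steps_Return_end:
  assumes "k \<le> M" "\<forall>j\<le>k. tB j < tA j" and X: "larger_ratio G a b (S k) (S 0) X"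
  shows "alg_steps G a b k Start (Return X)"
proof -
  have "e\<^sub>0 \<le> k" using k by (simp add: e0)
  then have "alg_steps G a b k Start (Loop (S k))" using assms by (intro steps_Loop) auto
  moreover have "alg_step G a b k (Loop (S k)) (Return X)"
    using X card_S[OF assms(1)] by (intro alg_step.finish) auto
  ultimately show ?thesis by (simp add: rtranclp.rtrancl_into_rtrancl)
qed

text \<open>\<open>cov i x\<close>: some shortest path from \<open>b\<close> to \<open>x\<close> starts with an \<open>us j\<close> that is joined to \<open>a\<close> in
  \<open>S i\<close>. For the vertices closer to \<open>b\<close> this is what brings \<open>a\<close> as close as \<open>b\<close>.\<close>

definition cov :: "nat \<Rightarrow> 'a \<Rightarrow> bool" where
  "cov i x \<longleftrightarrow> (\<exists>j. e\<^sub>0 \<le> j \<and> j < i \<and> d x (us j) + 1 = d x b)"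

lemma us_dist:
  assumes "e\<^sub>0 \<le> j" "j < M" "x \<in> V"
  shows "d x b \<le> d x (us j) + 1"
  using dist_edge[of "us j" b x] us_nbr[of j] assms dist_sym by (metis insert_commute)

text \<open>A shortest path from \<open>b\<close> to \<open>y\<close> through \<open>us j\<close>
  extends along an edge leading away from \<open>b\<close>.\<close>

lemma cov_edge:
  assumes e: "{y, z} \<in> edges G" and "d y b < d z b" "cov i y" "i \<le> M"
  shows "cov i z"
proof -
  obtain j where j: "e\<^sub>0 \<le> j" "j < i" "d y (us j) + 1 = d y b" using assms by (auto simp: cov_def)
  have V: "z \<in> V" using edge_verts e by blast
  have "d z (us j) \<le> d y (us j) + 1" using dist_edge[OF e us_in_V[of j]] j assms by simp
  moreover have "d z b \<le> d z (us j) + 1" using us_dist[of j z] j V assms by simp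
  ultimately have "d z (us j) + 1 = d z b" using assms j by linarith
  then show ?thesis using j by (auto simp: cov_def)
qed

text \<open>On a shortest path that witnesses coverage, the vertex before \<open>z\<close> is
  covered too, unless \<open>z\<close> is itself an end point. This is the recurrence that the
  propagation pass solves.\<close>

lemma cov_rec:
  assumes z: "z \<in> V" and i: "i \<le> M"
  shows "cov i z \<longleftrightarrow> (\<exists>j. e\<^sub>0 \<le> j \<and> j < i \<and> z = us j) \<or> (\<exists>y. {y, z} \<in> edges G \<and> d y b < d z b \<and> cov i y)"
    (is "_ = ?rhs")
proof
  assume "cov i z"
  then obtain j where j: "e\<^sub>0 \<le> j" "j < i" "d z (us j) + 1 = d z b" by (auto simp: cov_def)
  have jV: "us j \<in> V" using us_in_V j i by simp
  show ?rhs
  proof (cases "d z (us j)")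
    case 0
    then show ?thesis using j z jV by auto
  next
    case (Suc l)
    then obtain w where w: "{z, w} \<in> edges G" "w \<in> V" "d w (us j) = l"
      using dist_pred[OF z jV] by blast
    have "d w b \<le> d w (us j) + 1" using us_dist[of j w] j i w by simp
    moreover have "d z b \<le> d w b + 1" using dist_edge[of w z b] w ab by (simp add: insert_commute)
    ultimately have "d w (us j) + 1 = d w b" "d w b < d z b" using w Suc j by auto
    then show ?thesis using j w by (auto simp: cov_def insert_commute)
  qed
next
  assume ?rhs
  then show "cov i z"
  proof
    assume "\<exists>j. e\<^sub>0 \<le> j \<and> j < i \<and> z = us j"
    then obtain j where "e\<^sub>0 \<le> j" "j < i" "z = us j" by blast
    moreover have "d (us j) b = 1"
      using us_nbr[of j] calculation i dist_edge_1[of "us j" b] by (simp add: insert_commute)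
    ultimately show ?thesis by (auto simp: cov_def)
  qed (use cov_edge i in blast)
qed

text \<open>From a vertex closer to \<open>b\<close>, going through \<open>b\<close> costs
  \<open>d x b + 1\<close>, and a joined neighbour of \<open>b\<close> on a shortest path saves one
  step. The right-hand side is a potential, so nothing shorter exists.\<close>

lemma dist_S_a:
  assumes i: "e\<^sub>0 \<le> i" "i \<le> M" and x: "x \<in> V"
  shows "gdist (add_edges G (S i)) x a =
    (if d x b < d x a then if cov i x then d x b else d x b + 1 else d x a)"
    (is "gdist ?H x a = ?f x")
proof -
  have S: "star a b (S i)" using star_S i by simp
  then have Sv: "S i \<subseteq> vpairs V" by (simp add: star_def non_edges_vpairs)
  interpret H: conn_graph ?H by (rule conn_graph_add_edges) fact
  have vH: "verts ?H = V" by simp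
  have f_us: "?f (us j) \<le> 1" if "j < i" for j
  proof (cases "e\<^sub>0 \<le> j")
    case True
    have "d (us j) b = 1"
      using us_nbr[of j] that i True dist_edge_1[of "us j" b] by (simp add: insert_commute)
    moreover from this have "cov i (us j)" using True that by (auto simp: cov_def)
    ultimately show ?thesis by auto
  next
    case False
    then show ?thesis using us_before[of j] by auto
  qed
  have lip: "?f z \<le> ?f y + 1" if yz: "{y, z} \<in> edges ?H" for y z
  proof (cases "{y, z} \<in> edges G")
    case True
    then have "d z b \<le> d y b + 1" "d z a \<le> d y a + 1" "d y b \<le> d z b + 1" "d y a \<le> d z a + 1"
      using dist_edge[of y z] dist_edge[of z y] ab by (auto simp: insert_commute)
    \<comment> \<open>Rules out a jump by two from a covered to an uncovered vertex.\<close>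
    moreover have "cov i y \<Longrightarrow> \<not> cov i z \<Longrightarrow> d z b \<le> d y b"
      using cov_edge[OF True] i linorder_not_less by blast
    ultimately show ?thesis by auto
  next
    case False
    then obtain j where "j < i" "{y, z} = {a, us j}" using yz by (auto simp: S_def)
    then show ?thesis using f_us[of j] by (auto simp: doubleton_eq_iff)
  qed
  have fa: "?f a = 0" by simp
  have low: "?f x \<le> gdist ?H x a"
    by (rule H.potential_le_dist[where f = ?f]) (use lip fa x ab in \<open>auto simp del: One_nat_def\<close>)
  have "gdist ?H x a \<le> gdist ?H x b + gdist ?H b a"
    using H.dist_triangle[of x b a] x ab by simp
  moreover have "gdist ?H b a = 1"
    using S by (intro H.dist_edge_1) (simp add: star_def insert_commute)
  ultimately have upb: "gdist ?H x a \<le> d x b + 1"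
    using dist_add_edges_le[OF Sv x ab(2)] by simp
  have upc: "gdist ?H x a \<le> d x b" if c: "cov i x"
  proof -
    obtain j where j: "j < i" "d x (us j) + 1 = d x b" using c by (auto simp: cov_def)
    have "gdist ?H x a \<le> gdist ?H x (us j) + gdist ?H (us j) a"
      using H.dist_triangle[of x "us j" a] x ab us_in_V[of j] j i by simp
    moreover have "gdist ?H (us j) a = 1"
      using j by (intro H.dist_edge_1) (auto simp: S_def insert_commute)
    ultimately show ?thesis using dist_add_edges_le[OF Sv x us_in_V, of j] j i by simp
  qed
  show ?thesis using low upb upc dist_add_edges_le[OF Sv x ab(1)] by (auto split: if_splits)
qed

lemma total_S_b: "e\<^sub>0 \<le> i \<Longrightarrow> i \<le> M \<Longrightarrow> tB i = (\<Sum>x\<in>V. min (d x b) (d x a + 1))"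
  using dist_star(1)[OF ab(1,2) star_S] by (simp add: total_dist_def)

text \<open>Coverage brings a vertex closer to \<open>b\<close> one step nearer to \<open>a\<close>.
  As the right-hand side does not depend on \<open>i\<close>, consecutive totals differ by the
  number of newly covered vertices.\<close>

lemma total_S_a:
  assumes i: "e\<^sub>0 \<le> i" "i \<le> M" and F: "\<And>x. x \<in> V \<Longrightarrow> F x \<le> i \<longleftrightarrow> cov i x"
  shows "tA i + card {x \<in> V. d x b < d x a \<and> F x \<le> i} = (\<Sum>x\<in>V. min (d x a) (d x b + 1))"
proof -
  have "card {x \<in> V. d x b < d x a \<and> F x \<le> i} = (\<Sum>x\<in>V. if d x b < d x a \<and> F x \<le> i then 1 else 0)"
    by (simp add: sum.If_cases Int_def)
  then have "tA i + card {x \<in> V. d x b < d x a \<and> F x \<le> i}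
      = (\<Sum>x\<in>V. gdist (add_edges G (S i)) x a + (if d x b < d x a \<and> F x \<le> i then 1 else 0))"
    by (simp add: total_dist_def sum.distrib)
  also have "\<dots> = (\<Sum>x\<in>V. min (d x a) (d x b + 1))"
    by (rule sum.cong) (use dist_S_a[OF i] F in auto)
  finally show ?thesis .
qed

text \<open>Threshold by threshold, the hypothesis on \<open>F\<close> states a minimum over
  vertices strictly closer to \<open>b\<close>; induction on that distance matches it with the
  recurrence for \<open>cov\<close>.\<close>

lemma rank_cov:
  assumes F: "\<And>y r. y \<in> V \<Longrightarrow> F y \<le> r \<longleftrightarrow> F\<^sub>0 y \<le> r \<or> (\<exists>x. {x, y} \<in> edges G \<and> d x b < d y b \<and> F x \<le> r)"
    and F0: "\<And>y r. y \<in> V \<Longrightarrow> r \<le> M \<Longrightarrow> F\<^sub>0 y \<le> (r :: nat) \<longleftrightarrow> (\<exists>j. e\<^sub>0 \<le> j \<and> j < r \<and> y = us j)"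
    and "y \<in> V" and r: "r \<le> M"
  shows "F y \<le> r \<longleftrightarrow> cov r y"
  using \<open>y \<in> V\<close>
proof (induction "d y b" arbitrary: y rule: less_induct)
  case less
  have "F x \<le> r \<longleftrightarrow> cov r x" if "{x, y} \<in> edges G" "d x b < d y b" for x
    using less.hyps that edge_verts by blast
  then show ?case using F[OF less.prems, of r] F0[OF less.prems r] cov_rec[OF less.prems r] by blast
qed

end

section \<open>Weakest preconditions with running time\<close>

text \<open>The postcondition also receives the running time, so termination, correctness and cost
  are proved together.\<close>

definition wp :: "prog \<Rightarrow> memory \<Rightarrow> (nat \<Rightarrow> memory \<Rightarrow> bool) \<Rightarrow> bool" where
  "wp p s Q \<longleftrightarrow> (\<exists>t s'. runs p s t s' \<and> Q t s')"

inductive_cases runs_SkipE: "runs Skip s t s'"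
inductive_cases runs_WriteE: "runs (Write x i e) s t s'"
inductive_cases runs_SeqE: "runs (Seq p q) s t s'"
inductive_cases runs_IfE: "runs (IfLess e1 e2 p q) s t s'"

lemma wp_Skip: "wp Skip s Q \<longleftrightarrow> Q 1 s"
  unfolding wp_def by (metis runs.Skip runs_SkipE)

lemma wp_Write:
  "wp (Write x i e) s Q \<longleftrightarrow>
     Q (1 + expr_cost i + expr_cost e) (s(x := (s x)(eval_expr i s := eval_expr e s)))"
  unfolding wp_def by (metis runs.Write runs_WriteE)

lemma wp_Seq: "wp (Seq p q) s Q \<longleftrightarrow> wp p s (\<lambda>t s'. wp q s' (\<lambda>t' s''. Q (1 + t + t') s''))"
proof
  assume "wp (Seq p q) s Q"
  then obtain t s' where r: "runs (Seq p q) s t s'" "Q t s'" unfolding wp_def by blast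
  from r(1) show "wp p s (\<lambda>t s'. wp q s' (\<lambda>t' s''. Q (1 + t + t') s''))"
    by (rule runs_SeqE) (use r(2) in \<open>auto simp: wp_def\<close>)
next
  assume "wp p s (\<lambda>t s'. wp q s' (\<lambda>t' s''. Q (1 + t + t') s''))"
  then show "wp (Seq p q) s Q" unfolding wp_def by (blast intro: runs.Seq)
qed

lemma wp_If:
  "wp (IfLess e1 e2 p q) s Q \<longleftrightarrow>
     (if eval_expr e1 s < eval_expr e2 s
      then wp p s (\<lambda>t. Q (1 + expr_cost e1 + expr_cost e2 + t))
      else wp q s (\<lambda>t. Q (1 + expr_cost e1 + expr_cost e2 + t)))" (is "_ = ?r")
proof
  assume "wp (IfLess e1 e2 p q) s Q"
  then obtain t s' where r: "runs (IfLess e1 e2 p q) s t s'" "Q t s'" unfolding wp_def by blast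
  from r(1) show ?r by (rule runs_IfE) (use r(2) in \<open>auto simp: wp_def\<close>)
next
  assume ?r
  then show "wp (IfLess e1 e2 p q) s Q"
    unfolding wp_def using runs.IfTrue[of e1 s e2 p _ _ q] runs.IfFalse[of e1 s e2 q _ _ p]
    by (cases "eval_expr e1 s < eval_expr e2 s") (simp_all only: if_True if_False, blast+)
qed

lemmas wp_simps = wp_Skip wp_Write wp_Seq wp_If

fun writes :: "prog \<Rightarrow> string set" where
  "writes Skip = {}"
| "writes (Write x i e) = {x}"
| "writes (Seq p q) = writes p \<union> writes q"
| "writes (IfLess e1 e2 p q) = writes p \<union> writes q"
| "writes (WhileLess e1 e2 p) = writes p"

lemma runs_frame: "runs p s t s' \<Longrightarrow> x \<notin> writes p \<Longrightarrow> s' x = s x"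
  by (induction rule: runs.induct) auto

definition same_except :: "string set \<Rightarrow> memory \<Rightarrow> memory \<Rightarrow> bool" where
  "same_except X s s' \<longleftrightarrow> (\<forall>x. x \<notin> X \<longrightarrow> s' x = s x)"

text \<open>The consequence rule with a built-in frame: arrays that the program does not write keep
  their contents, so postconditions need not mention them.\<close>

lemma wp_mono:
  assumes "wp p s R" "\<And>t s'. R t s' \<Longrightarrow> same_except (writes p) s s' \<Longrightarrow> Q t s'"
  shows "wp p s Q"
  using assms runs_frame unfolding wp_def same_except_def by blast

text \<open>The potential \<open>\<Phi>\<close> bounds the running time of the remaining iterations.\<close>

lemma wp_While:
  assumes "I s"
    and step: "\<And>s'. I s' \<Longrightarrow> same_except (writes p) s s' \<Longrightarrow> eval_expr e1 s' < eval_expr e2 s' \<Longrightarrow>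
      wp p s' (\<lambda>t s''. I s'' \<and> 1 + expr_cost e1 + expr_cost e2 + t + \<Phi> s'' \<le> \<Phi> s')"
    and fin: "\<And>t s'. I s' \<Longrightarrow> same_except (writes p) s s' \<Longrightarrow> \<not> eval_expr e1 s' < eval_expr e2 s' \<Longrightarrow>
      t \<le> 1 + expr_cost e1 + expr_cost e2 + \<Phi> s \<Longrightarrow> Q t s'"
  shows "wp (WhileLess e1 e2 p) s Q"
proof -
  have "\<exists>t s'. runs (WhileLess e1 e2 p) s0 t s' \<and> I s' \<and> same_except (writes p) s s' \<and>
      \<not> eval_expr e1 s' < eval_expr e2 s' \<and> t \<le> 1 + expr_cost e1 + expr_cost e2 + \<Phi> s0"
    if "I s0" "same_except (writes p) s s0" for s0
    using that
  \<comment> \<open>Each iteration costs at least one unit, so \<open>\<Phi>\<close> strictly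
    decreases and also proves termination.\<close>
  proof (induction "\<Phi> s0" arbitrary: s0 rule: less_induct)
    case less
    show ?case
    proof (cases "eval_expr e1 s0 < eval_expr e2 s0")
      case True
      then obtain t s1 where r: "runs p s0 t s1" "I s1"
        "1 + expr_cost e1 + expr_cost e2 + t + \<Phi> s1 \<le> \<Phi> s0"
        using step[OF less.prems True] by (auto simp: wp_def)
      have s1: "same_except (writes p) s s1"
        using less.prems(2) runs_frame[OF r(1)] by (simp add: same_except_def)
      obtain t' s' where r': "runs (WhileLess e1 e2 p) s1 t' s'" "I s'" "same_except (writes p) s s'"
        "\<not> eval_expr e1 s' < eval_expr e2 s'" "t' \<le> 1 + expr_cost e1 + expr_cost e2 + \<Phi> s1"
        using less.hyps[of s1] r s1 by auto
      have "1 + expr_cost e1 + expr_cost e2 + t + t' \<le> 1 + expr_cost e1 + expr_cost e2 + \<Phi> s0"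
        using r(3) r'(5) by linarith
      then show ?thesis using runs.WhileTrue[OF True r(1) r'(1)] r' by blast
    next
      case False
      then show ?thesis using runs.WhileFalse[OF False] less.prems by fastforce
    qed
  qed
  then show ?thesis using fin \<open>I s\<close> unfolding wp_def by (fastforce simp: same_except_def)
qed

abbreviation var :: "string \<Rightarrow> expr" where "var x \<equiv> Read x (Const 0)"
abbreviation assign :: "string \<Rightarrow> expr \<Rightarrow> prog" where "assign x \<equiv> Write x (Const 0)"
abbreviation incr :: "string \<Rightarrow> prog" where "incr x \<equiv> assign x (Plus (var x) (Const 1))"

definition fill :: "string \<Rightarrow> expr \<Rightarrow> prog" where
  "fill x e = Seq (assign ''i'' (Const 0))
     (WhileLess (var ''i'') (var ''n'') (Seq (Write x (var ''i'') e) (incr ''i'')))"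

text \<open>The value may depend on the loop counter, so the same loop initialises and copies
  arrays.\<close>

lemma wp_fill:
  assumes x: "x \<noteq> ''i''" "x \<noteq> ''n''"
    and e: "\<And>s'. same_except {x, ''i''} s s' \<Longrightarrow> eval_expr e s' = c (s' ''i'' 0)" "expr_cost e \<le> 3"
  shows "wp (fill x e) s (\<lambda>t s'. t \<le> 40 * (1 + s ''n'' 0) \<and> (\<forall>v < s ''n'' 0. s' x v = c v))"
  unfolding fill_def wp_Seq wp_Write
proof (rule wp_While[where I = "\<lambda>s'. \<forall>v < s' ''i'' 0. s' x v = c v"
        and \<Phi> = "\<lambda>s'. 30 * (s ''n'' 0 - s' ''i'' 0)"], goal_cases)
  case (2 s')
  then have "s' ''n'' = s ''n''" "same_except {x, ''i''} s s'" using x by (auto simp: same_except_def)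
  with 2 x e(2) e(1)[of s'] show ?case by (auto simp: wp_simps less_Suc_eq)
next
  case (3 t s')
  then have "s' ''n'' = s ''n''" using x by (simp add: same_except_def)
  with 3 show ?case by auto
qed simp

section \<open>Breadth-first search\<close>

text \<open>Along a shortest path to \<open>v\<close> all smaller distances occur. Hence
  \<open>n\<close> can mark undiscovered vertices, and total distances are at most
  \<open>n * n\<close>.\<close>

lemma (in conn_graph) dist_less_card:
  assumes "u \<in> V" "v \<in> V"
  shows "d u v < card V"
proof -
  have *: "{..l} \<subseteq> (\<lambda>w. d w v) ` V" if "w \<in> V" "d w v = l" for l w
    using that
  proof (induction l arbitrary: w)
    case 0
    then have "0 \<in> (\<lambda>w. d w v) ` V" by (intro image_eqI[of _ _ w]) auto
    then show ?case by simp
  next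
    case (Suc l)
    obtain x where "x \<in> V" "d x v = l" using dist_pred[OF Suc.prems(1) assms(2) Suc.prems(2)] by blast
    moreover have "Suc l \<in> (\<lambda>w. d w v) ` V" using Suc.prems by (intro image_eqI[of _ _ w]) auto
    ultimately show ?case using Suc.IH[of x] by (simp add: atMost_Suc)
  qed
  have "{..d u v} \<subseteq> (\<lambda>w. d w v) ` V" by (rule *) (use assms in auto)
  then have "card {..d u v} \<le> card ((\<lambda>w. d w v) ` V)" by (intro card_mono) auto
  also have "\<dots> \<le> card V" by (rule card_image_le) auto
  finally show ?thesis by simp
qed

text \<open>The handshake bound: each edge comes from at most two ordered pairs.\<close>

lemma (in conn_graph) sum_card_nbrs_le: "(\<Sum>v\<in>V. card (nbrs G v)) \<le> 2 * card (edges G)"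
proof -
  have fin: "finite (nbrs G v)" for v
    using edge_verts by (auto simp: nbrs_def intro: finite_subset[of _ V])
  define P where "P e = {(u, v). e = {u, v}}" for e :: "'a set"
  have P: "finite (P e) \<and> card (P e) \<le> 2" if e: "e \<in> edges G" for e
  proof -
    obtain x y where "e = {x, y}" using e simple by (auto simp: simple_graph_def vpairs_def)
    then have sub: "P e \<subseteq> {(x, y), (y, x)}" by (auto simp: P_def doubleton_eq_iff)
    have "card (P e) \<le> card {(x, y), (y, x)}" by (rule card_mono[OF _ sub]) simp
    also have "\<dots> \<le> 2" using card_length[of "[(x, y), (y, x)]"] by simp
    finally show ?thesis using finite_subset[OF sub] by simp
  qed
  have "(\<Sum>v\<in>V. card (nbrs G v)) = card (SIGMA v:V. nbrs G v)" using fin by simp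
  also have "\<dots> \<le> card (\<Union>e\<in>edges G. P e)"
  proof (rule card_mono)
    show "finite (\<Union>e\<in>edges G. P e)" using finite_edges P by blast
    show "(SIGMA v:V. nbrs G v) \<subseteq> (\<Union>e\<in>edges G. P e)" by (auto simp: nbrs_def P_def)
  qed
  also have "\<dots> \<le> (\<Sum>e\<in>edges G. card (P e))"
    by (rule card_UN_le[OF finite_edges])
  also have "\<dots> \<le> (\<Sum>e\<in>edges G. 2)"
    by (rule sum_mono) (use P in blast)
  finally show ?thesis by simp
qed

section \<open>Encoded graphs and the cost of scanning adjacency lists\<close>

locale encoded_instance = alg_instance G a b k for G :: "nat ugraph" and a b k +
  fixes n :: nat and off adj :: "nat \<Rightarrow> nat"
  assumes V_eq: "V = {..<n}" and off_0: "off 0 = 0"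
    and off_mono: "v < n \<Longrightarrow> off v \<le> off (Suc v)"
    and adj_bij: "v < n \<Longrightarrow> bij_betw adj {off v..<off (Suc v)} (nbrs G v)"
begin

definition inp :: "memory \<Rightarrow> bool" where
  "inp s \<longleftrightarrow> s ''n'' 0 = n \<and> s ''a'' 0 = a \<and> s ''b'' 0 = b \<and> s ''k'' 0 = k \<and> s ''off'' = off \<and> s ''adj'' = adj"

lemma nbrs_adj: "v < n \<Longrightarrow> nbrs G v = adj ` {off v..<off (Suc v)}"
  using adj_bij by (simp add: bij_betw_def)

lemma adj_edge: "v < n \<Longrightarrow> off v \<le> j \<Longrightarrow> j < off (Suc v) \<Longrightarrow> {v, adj j} \<in> edges G"
  using nbrs_adj[of v] by (auto simp: nbrs_def)

lemma adj_less: "v < n \<Longrightarrow> off v \<le> j \<Longrightarrow> j < off (Suc v) \<Longrightarrow> adj j < n"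
  using adj_edge[of v j] edge_verts V_eq by auto

lemma card_V: "card V = n"
  by (simp add: V_eq)

lemma ab_less: "a < n" "b < n"
  using ab V_eq by auto

lemma dist_less: "u < n \<Longrightarrow> v < n \<Longrightarrow> d u v < n"
  using dist_less_card[of u v] by (simp add: V_eq)

abbreviation deg :: "nat \<Rightarrow> nat" where "deg v \<equiv> off (Suc v) - off v"

lemma sum_deg: "(\<Sum>v<n. deg v) = off n"
proof -
  have "m \<le> n \<Longrightarrow> (\<Sum>v<m. deg v) = off m" for m
    by (induction m) (use off_mono in \<open>auto simp: off_0\<close>)
  then show ?thesis by simp
qed

lemma off_n_le: "off n \<le> 2 * card (edges G)"
proof -
  have "deg v = card (nbrs G v)" if "v < n" for v
    using bij_betw_same_card[OF adj_bij[OF that]] by simp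
  then show ?thesis using sum_card_nbrs_le by (simp add: V_eq flip: sum_deg)
qed

text \<open>Number of steps of a traversal that has scanned the adjacency lists of \<open>q 0, \<dots>, q (h - 1)\<close>
  and has reached position \<open>j\<close> in the list of \<open>q h\<close>.\<close>

definition work :: "(nat \<Rightarrow> nat) \<Rightarrow> nat \<Rightarrow> nat \<Rightarrow> nat" where
  "work q h j = (\<Sum>i<h. Suc (deg (q i))) + (j - off (q h))"

lemma work_Suc: "off (q h) \<le> j \<Longrightarrow> work q h (Suc j) = Suc (work q h j)"
  by (simp add: work_def)

lemma work_upd: "h < t \<Longrightarrow> work (q(t := y)) h j = work q h j"
  by (simp add: work_def)

lemma work_advance: "work q (Suc h) (off (q (Suc h))) = Suc (work q h (off (Suc (q h))))"
  by (simp add: work_def)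

text \<open>Queue entries are distinct, so every adjacency list is charged once. Strictness leaves
  one unit for the iteration under way.\<close>

lemma work_less:
  assumes "inj_on q {..<t}" "\<forall>i<t. q i < n" "h < t" "j \<le> off (Suc (q h))"
  shows "work q h j < n + off n"
proof -
  have "work q h j < (\<Sum>i<Suc h. Suc (deg (q i)))" using assms by (simp add: work_def)
  also have "\<dots> \<le> (\<Sum>i<t. Suc (deg (q i)))" by (rule sum_mono2) (use assms in auto)
  also have "\<dots> = (\<Sum>v\<in>q ` {..<t}. Suc (deg v))" using assms by (simp add: sum.reindex)
  also have "\<dots> \<le> (\<Sum>v<n. Suc (deg v))" by (rule sum_mono2) (use assms in auto)
  also have "\<dots> = n + (\<Sum>v<n. deg v)" by (simp only: sum.distrib Suc_eq_plus1) simp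
  finally show ?thesis by (simp add: sum_deg)
qed

text \<open>\<open>D v < n\<close> marks discovered vertices, and the queue lists them by distance.
  While \<open>h < t\<close>, the queue reaches at most one layer beyond its head \<open>q h\<close>
  and contains every vertex not farther than the head; \<open>j\<close> is the position in the
  head's list.\<close>

definition bfs_inv :: "nat \<Rightarrow> (nat \<Rightarrow> nat) \<Rightarrow> (nat \<Rightarrow> nat) \<Rightarrow> nat \<Rightarrow> nat \<Rightarrow> nat \<Rightarrow> bool" where
  "bfs_inv r D q h t j \<longleftrightarrow>
     inj_on q {..<t} \<and> (\<forall>i<t. q i < n \<and> D (q i) = d (q i) r) \<and>
     (\<forall>v<n. D v < n \<longleftrightarrow> v \<in> q ` {..<t}) \<and>
     (\<forall>i i'. i \<le> i' \<longrightarrow> i' < t \<longrightarrow> d (q i) r \<le> d (q i') r) \<and>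
     r \<in> q ` {..<t} \<and> h \<le> t \<and> (\<forall>i<h. nbrs G (q i) \<subseteq> q ` {..<t}) \<and>
     (h < t \<longrightarrow> off (q h) \<le> j \<and> j \<le> off (Suc (q h)) \<and> adj ` {off (q h)..<j} \<subseteq> q ` {..<t} \<and>
        (\<forall>i<t. d (q i) r \<le> d (q h) r + 1) \<and>
        (\<forall>z<n. d z r \<le> d (q h) r \<longrightarrow> z \<in> q ` {..<t}))"

lemma bfs_inv_init:
  assumes "r < n" "\<forall>v<n. D v = n" "q 0 = r"
  shows "bfs_inv r (D(r := 0)) q 0 1 (off r)"
  using assms off_mono V_eq by (auto simp: bfs_inv_def lessThan_Suc)

lemma bfs_inv_visit:
  assumes "bfs_inv r D q h t j" "h < t" "j < off (Suc (q h))" "D (adj j) < n"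
  shows "bfs_inv r D q h t (Suc j)"
proof -
  have "adj j < n" using adj_less[of "q h" j] assms by (auto simp: bfs_inv_def)
  then have "adj j \<in> q ` {..<t}" using assms by (auto simp: bfs_inv_def)
  moreover have "{off (q h)..<Suc j} = insert j {off (q h)..<j}" using assms by (auto simp: bfs_inv_def)
  ultimately show ?thesis using assms by (simp add: bfs_inv_def)
qed

lemma bfs_inv_discover:
  assumes inv: "bfs_inv r D q h t j" and ht: "h < t" and j: "j < off (Suc (q h))"
    and new: "\<not> D (adj j) < n" and r: "r < n"
  shows "bfs_inv r (D(adj j := D (q h) + 1)) (q(t := adj j)) h (Suc t) (Suc j)"
proof -
  define y where "y = adj j"
  have qh: "q h < n" "off (q h) \<le> j" "D (q h) = d (q h) r" using inv ht by (auto simp: bfs_inv_def)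
  have yn: "y < n" and e: "{q h, y} \<in> edges G" using adj_less[of "q h" j] adj_edge[of "q h" j] j qh by (auto simp: y_def)
  have y: "y \<notin> q ` {..<t}" using inv new yn by (auto simp: bfs_inv_def y_def)
  have "d y r \<le> d (q h) r + 1" using dist_edge[OF e] r V_eq by simp
  \<comment> \<open>A vertex not farther than the head would already be in the queue.\<close>
  moreover have "\<not> d y r \<le> d (q h) r" using inv ht yn y by (auto simp: bfs_inv_def)
  ultimately have dy: "d y r = d (q h) r + 1" by simp
  have im: "(q(t := y)) ` {..<Suc t} = insert y (q ` {..<t})" by (auto simp: lessThan_Suc)
  have adj_im: "adj ` {off (q h)..<Suc j} = insert y (adj ` {off (q h)..<j})"
    using qh by (auto simp: y_def less_Suc_eq)
  have ne: "q i \<noteq> y" if "i < t" for i using y that by auto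
  have inj: "inj_on (q(t := y)) {..<Suc t}"
    using inv y by (auto simp: bfs_inv_def lessThan_Suc inj_on_fun_updI)
  \<comment> \<open>True distances stay below \<open>n\<close>, so the value written counts as a
    discovery mark.\<close>
  have dyn: "d (q h) r + 1 < n" using dist_less[OF yn r] dy by simp
  have far: "d (q i) r \<le> d (q h) r + 1" if "i < t" for i using inv ht that by (auto simp: bfs_inv_def)
  show ?thesis
    unfolding bfs_inv_def y_def[symmetric] im
  proof (intro conjI)
    show "\<forall>i<Suc t. (q(t := y)) i < n \<and> (D(y := D (q h) + 1)) ((q(t := y)) i) = d ((q(t := y)) i) r"
      using inv ne yn dy qh by (auto simp: bfs_inv_def less_Suc_eq)
    show "\<forall>v<n. (D(y := D (q h) + 1)) v < n \<longleftrightarrow> v \<in> insert y (q ` {..<t})"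
      using inv dyn qh by (auto simp: bfs_inv_def)
    show "\<forall>i i'. i \<le> i' \<longrightarrow> i' < Suc t \<longrightarrow> d ((q(t := y)) i) r \<le> d ((q(t := y)) i') r"
      using inv far dy by (auto simp: bfs_inv_def less_Suc_eq)
    show "\<forall>i<h. nbrs G ((q(t := y)) i) \<subseteq> insert y (q ` {..<t})"
      using inv ht by (auto simp: bfs_inv_def)
  qed (use inv inj ht j qh adj_im far dy in \<open>auto simp: bfs_inv_def less_Suc_eq\<close>)
qed

lemma bfs_inv_advance:
  assumes inv: "bfs_inv r D q h t j" and ht: "h < t" and j: "\<not> j < off (Suc (q h))" and r: "r < n"
  shows "bfs_inv r D q (Suc h) t (off (q (Suc h)))"
proof -
  have qh: "q h < n" "j = off (Suc (q h))" using inv ht j by (auto simp: bfs_inv_def)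
  have nb: "nbrs G (q h) \<subseteq> q ` {..<t}" using inv ht qh nbrs_adj[of "q h"] by (auto simp: bfs_inv_def)
  have mono: "i \<le> i' \<Longrightarrow> i' < t \<Longrightarrow> d (q i) r \<le> d (q i') r" for i i' using inv by (auto simp: bfs_inv_def)
  have scanned: "nbrs G (q i) \<subseteq> q ` {..<t}" if "i < Suc h" for i
    using inv nb that by (auto simp: bfs_inv_def less_Suc_eq)
  have "z \<in> q ` {..<t}" if z: "z < n" "d z r \<le> d (q (Suc h)) r" and h: "Suc h < t" for z
  proof (cases "d z r \<le> d (q h) r")
    case True
    then show ?thesis using inv ht z by (auto simp: bfs_inv_def)
  next
    case False
    have "d (q (Suc h)) r \<le> d (q h) r + 1" using inv ht h by (auto simp: bfs_inv_def)
    then have dz: "d z r = Suc (d (q h) r)" "d (q (Suc h)) r = Suc (d (q h) r)" using False z by auto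
    \<comment> \<open>This predecessor lies in the old head's layer, hence before the new head in
      the sorted queue, and its list has been scanned.\<close>
    then obtain w where w: "{z, w} \<in> edges G" "w \<in> V" "d w r = d (q h) r"
      using dist_pred[of z r] z r V_eq by auto
    then have "w \<in> q ` {..<t}" using inv ht V_eq by (auto simp: bfs_inv_def)
    then obtain i where i: "i < t" "w = q i" by auto
    then have "i < Suc h" using mono[of "Suc h" i] dz w by (auto simp: not_less[symmetric])
    then show ?thesis using scanned[of i] w i by (auto simp: nbrs_def insert_commute)
  qed
  moreover have "d (q i) r \<le> d (q (Suc h)) r + 1" if "Suc h < t" "i < t" for i
  proof -
    have "d (q i) r \<le> d (q h) r + 1" using inv ht that(2) by (auto simp: bfs_inv_def)
    then show ?thesis using mono[of h "Suc h"] that(1) by simp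
  qed
  moreover have "Suc h < t \<Longrightarrow> off (q (Suc h)) \<le> off (Suc (q (Suc h)))"
    using inv off_mono by (auto simp: bfs_inv_def)
  ultimately show ?thesis using inv ht scanned by (simp add: bfs_inv_def)
qed

text \<open>The order of discovery is recorded because the propagation pass visits the vertices in
  it.\<close>

definition bfs_result :: "nat \<Rightarrow> (nat \<Rightarrow> nat) \<Rightarrow> (nat \<Rightarrow> nat) \<Rightarrow> bool" where
  "bfs_result r D q \<longleftrightarrow> (\<forall>v<n. D v = d v r) \<and> bij_betw q {..<n} {..<n} \<and>
     (\<forall>i i'. i \<le> i' \<longrightarrow> i' < n \<longrightarrow> d (q i) r \<le> d (q i') r)"

lemma bfs_inv_final:
  assumes inv: "bfs_inv r D q h t j" and ht: "\<not> h < t" and r: "r < n"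
  shows "bfs_result r D q"
proof -
  have h: "h = t" using inv ht by (auto simp: bfs_inv_def)
  have closed: "nbrs G (q i) \<subseteq> q ` {..<t}" if "i < t" for i using inv that h by (auto simp: bfs_inv_def)
  have all: "v \<in> q ` {..<t}" if "v < n" for v
    using that
  proof (induction "d v r" arbitrary: v)
    case 0
    then show ?case using inv r V_eq by (auto simp: bfs_inv_def)
  next
    case (Suc l)
    then obtain w where w: "{v, w} \<in> edges G" "w \<in> V" "d w r = l"
      using dist_pred[of v r l] r V_eq by auto
    then obtain i where "i < t" "w = q i" using Suc.hyps(1)[of w] V_eq by auto
    then show ?case using closed[of i] w by (auto simp: nbrs_def insert_commute)
  qed
  have im: "q ` {..<t} = {..<n}" using all inv by (auto simp: bfs_inv_def)
  then have "t = n" using inv card_image[of q "{..<t}"] by (simp add: bfs_inv_def)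
  moreover have "D v = d v r" if "v < n" for v using all[OF that] inv by (auto simp: bfs_inv_def)
  ultimately show ?thesis using inv im by (simp add: bfs_inv_def bfs_result_def bij_betw_def)
qed

end

text \<open>One flat loop replaces two nested ones: an iteration either scans one list entry or
  advances the head, which is one unit of \<open>work\<close>.\<close>

definition bfs :: prog where
  "bfs =
     Seq (fill ''dist'' (var ''n''))
    (Seq (Write ''dist'' (var ''src'') (Const 0))
    (Seq (Write ''q'' (Const 0) (var ''src''))
    (Seq (assign ''h'' (Const 0))
    (Seq (assign ''t'' (Const 1))
    (Seq (assign ''j'' (Read ''off'' (var ''src'')))
    (WhileLess (var ''h'') (var ''t'')
      (IfLess (var ''j'') (Read ''off'' (Plus (Read ''q'' (var ''h'')) (Const 1)))
        (Seq (assign ''y'' (Read ''adj'' (var ''j'')))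
        (Seq (incr ''j'')
          (IfLess (Read ''dist'' (var ''y'')) (var ''n'')
            Skip
            (Seq (Write ''dist'' (var ''y'') (Plus (Read ''dist'' (Read ''q'' (var ''h''))) (Const 1)))
            (Seq (Write ''q'' (var ''t'') (var ''y''))
              (incr ''t''))))))
        (Seq (incr ''h'')
          (assign ''j'' (Read ''off'' (Read ''q'' (var ''h''))))))))))))"

context encoded_instance
begin

lemma wp_bfs:
  assumes s: "inp s" "s ''src'' 0 = r" "r < n"
  shows "wp bfs s (\<lambda>t s'. t \<le> 200 * (1 + n + off n) \<and> bfs_result r (s' ''dist'') (s' ''q''))"
  unfolding bfs_def wp_Seq
proof (rule wp_mono[OF wp_fill[where c = "\<lambda>_. n"]], goal_cases)
  case (5 t0 s0)
  have s0: "inp s0" "s0 ''src'' 0 = r" "\<forall>v<n. s0 ''dist'' v = n" "t0 \<le> 40 * (1 + n)"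
    using 5 s by (simp_all add: inp_def same_except_def fill_def)
  show ?case
    unfolding wp_Write
  proof (rule wp_While[where I = "\<lambda>s. bfs_inv r (s ''dist'') (s ''q'') (s ''h'' 0) (s ''t'' 0) (s ''j'' 0)
        \<and> s ''j'' 0 \<ge> off (s ''q'' (s ''h'' 0))"
        and \<Phi> = "\<lambda>s. 100 * (n + off n - work (s ''q'') (s ''h'' 0) (s ''j'' 0))"], goal_cases)
    case 1
    show ?case using s0 bfs_inv_init[of r "s0 ''dist''" "(s0 ''q'')(0 := r)"] s by (simp add: inp_def)
  next
    case (2 s')
    have s': "s' ''n'' 0 = n" "s' ''off'' = off" "s' ''adj'' = adj"
      using 2(2) s0(1) by (simp_all add: inp_def same_except_def)
    define D q h t j where "D = s' ''dist''" and "q = s' ''q''" and "h = s' ''h'' 0"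
      and "t = s' ''t'' 0" and "j = s' ''j'' 0"
    note defs = D_def[symmetric] q_def[symmetric] h_def[symmetric] t_def[symmetric] j_def[symmetric]
    have inv: "bfs_inv r D q h t j" and ht: "h < t" and jl: "off (q h) \<le> j"
      using 2(1,3) by (simp_all add: defs)
    have w: "work q h j < n + off n"
      using inv ht by (intro work_less[of q t]) (auto simp: bfs_inv_def)
    show ?case
    proof (cases "j < off (Suc (q h))")
      case True
      show ?thesis
      proof (cases "D (adj j) < n")
        case y: True
        show ?thesis using bfs_inv_visit[OF inv ht True y] True y w jl s'
          by (simp add: wp_simps defs work_Suc)
      next
        case y: False
        show ?thesis using bfs_inv_discover[OF inv ht True y s(3)] True y w jl ht s'
          by (simp add: wp_simps defs work_Suc work_upd)
      qed
    next
      case False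
      then have "j = off (Suc (q h))" using inv ht by (auto simp: bfs_inv_def)
      then show ?thesis using bfs_inv_advance[OF inv ht False s(3)] w s'
        by (simp add: wp_simps defs work_advance)
    qed
  next
    case (3 t' s')
    have "bfs_inv r (s' ''dist'') (s' ''q'') (s' ''h'' 0) (s' ''t'' 0) (s' ''j'' 0)"
      "\<not> s' ''h'' 0 < s' ''t'' 0"
      using 3(1,3) by simp_all
    then have "bfs_result r (s' ''dist'') (s' ''q'')" using s(3) by (rule bfs_inv_final)
    then show ?case using 3(4) s0(4) by simp
  qed
qed (use s in \<open>simp_all add: inp_def same_except_def\<close>)

end

section \<open>Enumerating and ranking the neighbours\<close>

text \<open>\<open>1 < da[y]\<close> tests that \<open>y\<close> is outside the closed neighbourhood
  of \<open>a\<close>. As \<open>m\<close> is incremented first, \<open>f[y]\<close> is the position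
  plus one, the length of the shortest prefix containing \<open>y\<close>.\<close>

definition enum_loop :: prog where
  "enum_loop =
    WhileLess (var ''j'') (Read ''off'' (Plus (var ''b'') (Const 1)))
      (Seq (assign ''y'' (Read ''adj'' (var ''j'')))
      (Seq (incr ''j'')
        (IfLess (Const 1) (Read ''da'' (var ''y''))
          (Seq (Write ''out1'' (var ''m'') (var ''a''))
          (Seq (Write ''out2'' (var ''m'') (var ''y''))
          (Seq (incr ''m'')
            (Write ''f'' (var ''y'') (var ''m'')))))
          Skip)))"

text \<open>The default \<open>n\<close> in \<open>f\<close> stands for never. The output arrays
  receive the whole enumeration, so that choosing an answer only means choosing a prefix
  length.\<close>

definition enum_nbrs :: prog where
  "enum_nbrs =
     Seq (fill ''f'' (var ''n''))
    (Seq (fill ''cnt'' (Const 0))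
    (Seq (assign ''m'' (Const 0))
    (Seq (IfLess (Const 1) (Read ''da'' (var ''b''))
           (Seq (Write ''out1'' (var ''m'') (var ''a''))
           (Seq (Write ''out2'' (var ''m'') (var ''b''))
             (incr ''m'')))
           Skip)
    (Seq (assign ''e'' (var ''m''))
    (Seq (assign ''j'' (Read ''off'' (var ''b'')))
      enum_loop)))))"

text \<open>Vertices are visited by increasing distance to \<open>b\<close>, so the values read at
  strictly closer neighbours are final.\<close>

definition propagate :: prog where
  "propagate =
     Seq (assign ''h'' (Const 0))
    (Seq (assign ''j'' (Read ''off'' (Read ''q'' (Const 0))))
    (WhileLess (var ''h'') (var ''n'')
      (IfLess (var ''j'') (Read ''off'' (Plus (Read ''q'' (var ''h'')) (Const 1)))
        (Seq (assign ''y'' (Read ''adj'' (var ''j'')))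
        (Seq (incr ''j'')
          (IfLess (Read ''dist'' (var ''y'')) (Read ''dist'' (Read ''q'' (var ''h'')))
            (IfLess (Read ''f'' (var ''y'')) (Read ''f'' (Read ''q'' (var ''h'')))
              (Write ''f'' (Read ''q'' (var ''h'')) (Read ''f'' (var ''y'')))
              Skip)
            Skip)))
        (Seq (incr ''h'')
          (assign ''j'' (Read ''off'' (Read ''q'' (var ''h''))))))))"

context encoded_instance
begin

definition first :: nat where
  "first = (if {a, b} \<in> edges G then 0 else 1)"

definition enum_inv :: "(nat \<Rightarrow> nat) \<Rightarrow> (nat \<Rightarrow> nat) \<Rightarrow> (nat \<Rightarrow> nat) \<Rightarrow> nat \<Rightarrow> nat \<Rightarrow> bool" where
  "enum_inv out us f m j \<longleftrightarrow>
     first \<le> m \<and> ({a, b} \<notin> edges G \<longrightarrow> us 0 = b) \<and>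
     off b \<le> j \<and> j \<le> off (Suc b) \<and> inj_on us {first..<m} \<and>
     us ` {first..<m} = {u \<in> adj ` {off b..<j}. 1 < d u a} \<and>
     (\<forall>i<m. out i = a) \<and> (\<forall>i. first \<le> i \<longrightarrow> i < m \<longrightarrow> f (us i) = Suc i) \<and>
     (\<forall>y<n. y \<notin> us ` {first..<m} \<longrightarrow> f y = n)"

lemma enum_inv_skip:
  assumes "enum_inv out us f m j" "j < off (Suc b)" "\<not> 1 < d (adj j) a"
  shows "enum_inv out us f m (Suc j)"
proof -
  have "{off b..<Suc j} = insert j {off b..<j}" using assms by (auto simp: enum_inv_def)
  then have "{u \<in> adj ` {off b..<Suc j}. 1 < d u a} = {u \<in> adj ` {off b..<j}. 1 < d u a}"
    using assms by auto
  then show ?thesis using assms by (simp add: enum_inv_def)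
qed

lemma enum_inv_add:
  assumes inv: "enum_inv out us f m j" and j: "j < off (Suc b)" and far: "1 < d (adj j) a"
  shows "enum_inv (out(m := a)) (us(m := adj j)) (f(adj j := Suc m)) (Suc m) (Suc j)"
proof -
  have jb: "off b \<le> j" and em: "first \<le> m" using inv by (auto simp: enum_inv_def)
  have "{off b..<Suc j} = insert j {off b..<j}" using jb by auto
  then have im: "{u \<in> adj ` {off b..<Suc j}. 1 < d u a} = insert (adj j) {u \<in> adj ` {off b..<j}. 1 < d u a}"
    using far by auto
  have inj: "inj_on adj {off b..<off (Suc b)}" using adj_bij[OF ab_less(2)] by (simp add: bij_betw_def)
  \<comment> \<open>An adjacency list names each neighbour once.\<close>
  have "adj j \<noteq> adj i" if "off b \<le> i" "i < j" for i
    using inj_on_eq_iff[OF inj, of j i] that j jb by auto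
  then have "adj j \<notin> adj ` {off b..<j}" by (metis atLeastLessThan_iff imageE)
  then have new: "adj j \<notin> us ` {first..<m}" using inv by (auto simp: enum_inv_def)
  have ran: "{first..<Suc m} = insert m {first..<m}" using em by auto
  have im': "(us(m := adj j)) ` {first..<Suc m} = insert (adj j) (us ` {first..<m})"
    by (auto simp: ran)
  \<comment> \<open>If \<open>ab\<close> is absent, the entry \<open>b\<close> at position 0 is not
    overwritten.\<close>
  have "first = m \<Longrightarrow> {a, b} \<notin> edges G \<Longrightarrow> m \<noteq> 0" using inv by (auto simp: enum_inv_def first_def)
  moreover have "inj_on (us(m := adj j)) {first..<Suc m}"
    using inv new by (auto simp: enum_inv_def ran intro: inj_on_fun_updI)
  moreover have "f (us i) = Suc i" if "first \<le> i" "i < m" for i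
    using inv that by (simp add: enum_inv_def)
  moreover have "us i \<noteq> adj j" if "first \<le> i" "i < m" for i
    using new that by (metis atLeastLessThan_iff image_eqI)
  moreover have "\<forall>y<n. y \<notin> insert (adj j) (us ` {first..<m}) \<longrightarrow> (f(adj j := Suc m)) y = n"
    using inv by (auto simp: enum_inv_def)
  ultimately show ?thesis
    unfolding enum_inv_def im im' using inv j jb em
    by (auto simp: enum_inv_def less_Suc_eq)
qed

lemma enum_inv_final:
  assumes inv: "enum_inv out us f m j" and j: "\<not> j < off (Suc b)"
  shows "star_order G a b k us first m"
    and "\<And>y r. y \<in> V \<Longrightarrow> r \<le> m \<Longrightarrow> f y \<le> r \<longleftrightarrow> (\<exists>i. first \<le> i \<and> i < r \<and> y = us i)"
proof -
  have far: "1 < d u a \<longleftrightarrow> u \<notin> closed_nbrs G a" if "u \<in> V" for u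
  proof -
    have "1 < d u a \<longleftrightarrow> d u a \<noteq> 0 \<and> d u a \<noteq> 1" by linarith
    then show ?thesis using dist_1_iff[OF that ab(1)] dist_0_iff[OF that ab(1)]
      by (auto simp: closed_nbrs_def nbrs_def insert_commute)
  qed
  have "j = off (Suc b)" using inv j by (auto simp: enum_inv_def)
  then have "us ` {first..<m} = {u \<in> nbrs G b. 1 < d u a}"
    using inv nbrs_adj[OF ab_less(2)] by (simp add: enum_inv_def)
  also have "\<dots> = nbrs G b - closed_nbrs G a" using far edge_verts by (auto simp: nbrs_def)
  finally have "bij_betw us {first..<m} (nbrs G b - closed_nbrs G a)"
    using inv by (simp add: enum_inv_def bij_betw_def)
  then show "star_order G a b k us first m"
    using inv by unfold_locales (auto simp: enum_inv_def first_def)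
  then interpret star_order G a b k us first m .
  fix y r assume y: "y \<in> V" and r: "r \<le> m"
  show "f y \<le> r \<longleftrightarrow> (\<exists>i. first \<le> i \<and> i < r \<and> y = us i)"
  proof (cases "y \<in> us ` {first..<m}")
    case True
    then obtain i where i: "first \<le> i" "i < m" "y = us i" by auto
    then have "f y = Suc i" using inv by (simp add: enum_inv_def)
    moreover have "y = us i' \<longleftrightarrow> i' = i" if "i' < r" for i' using i r that us_eq_iff[of i i'] by auto
    then have "(\<exists>i'. first \<le> i' \<and> i' < r \<and> y = us i') \<longleftrightarrow> i < r" using i by blast
    ultimately show ?thesis by (simp add: Suc_le_eq)
  next
    case False
    then have "f y = n" using inv y V_eq by (simp add: enum_inv_def)
    \<comment> \<open>The default exceeds every threshold \<open>r \<le> m\<close>.\<close>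
    moreover have "m < n" using M_less by (simp add: V_eq)
    ultimately show ?thesis using False r by auto
  qed
qed

definition enum_result :: "memory \<Rightarrow> bool" where
  "enum_result s \<longleftrightarrow> star_order G a b k (s ''out2'') (s ''e'' 0) (s ''m'' 0) \<and>
     (\<forall>i < s ''m'' 0. s ''out1'' i = a) \<and> (\<forall>v<n. s ''cnt'' v = 0) \<and>
     (\<forall>y\<in>V. \<forall>r \<le> s ''m'' 0. s ''f'' y \<le> r \<longleftrightarrow> (\<exists>i. s ''e'' 0 \<le> i \<and> i < r \<and> y = s ''out2'' i))"

lemma wp_enum_nbrs:
  assumes s: "inp s" "\<forall>v<n. s ''da'' v = d v a"
  shows "wp enum_nbrs s (\<lambda>t s'. t \<le> 300 * (1 + n + off n) \<and> enum_result s')"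
  unfolding enum_nbrs_def wp_Seq
proof (rule wp_mono[OF wp_fill[where c = "\<lambda>_. n"]], goal_cases)
  case (5 t0 s0)
  have s0: "inp s0" "\<forall>v<n. s0 ''da'' v = d v a" "\<forall>v<n. s0 ''f'' v = n" "t0 \<le> 40 * (1 + n)"
    using 5 s by (simp_all add: inp_def same_except_def fill_def)
  show ?case
  proof (rule wp_mono[OF wp_fill[where c = "\<lambda>_. 0"]], goal_cases)
    case (5 t1 s1)
    have s1: "inp s1" "\<forall>v<n. s1 ''da'' v = d v a" "\<forall>v<n. s1 ''f'' v = n" "\<forall>v<n. s1 ''cnt'' v = 0"
      "t1 \<le> 40 * (1 + n)"
      using 5 s0 by (simp_all add: inp_def same_except_def fill_def)
    have "d b a \<noteq> 0" using ab by simp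
    then have "1 < d b a \<longleftrightarrow> d b a \<noteq> 1" by linarith
    then have dab: "1 < d b a \<longleftrightarrow> {a, b} \<notin> edges G" using dist_1_iff[of b a] ab by (simp add: insert_commute)
    have off_b: "off b \<le> off (Suc b)" "off (Suc b) \<le> off n"
    proof -
      show "off b \<le> off (Suc b)" using off_mono ab_less by simp
      have "(\<Sum>v<Suc b. deg v) \<le> (\<Sum>v<n. deg v)" by (rule sum_mono2) (use ab_less in auto)
      moreover have "l \<le> n \<Longrightarrow> (\<Sum>v<l. deg v) = off l" for l
        by (induction l) (use off_mono in \<open>auto simp: off_0\<close>)
      ultimately show "off (Suc b) \<le> off n" using ab_less by simp
    qed
    have loop: "wp enum_loop s3 (\<lambda>t s'. t \<le> 20 + 100 * off n \<and> enum_result s')"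
      if s3: "inp s3" "\<forall>v<n. s3 ''da'' v = d v a" "\<forall>v<n. s3 ''cnt'' v = 0" "s3 ''e'' 0 = first"
        "enum_inv (s3 ''out1'') (s3 ''out2'') (s3 ''f'') (s3 ''m'' 0) (s3 ''j'' 0)" for s3
      unfolding enum_loop_def
    proof (rule wp_While[where I = "\<lambda>s. enum_inv (s ''out1'') (s ''out2'') (s ''f'') (s ''m'' 0) (s ''j'' 0)"
          and \<Phi> = "\<lambda>s. 100 * (off (Suc b) - s ''j'' 0)"], goal_cases)
      case 1
      show ?case by (rule s3(5))
    next
      case (2 s')
      have s': "s' ''off'' = off" "s' ''adj'' = adj" "s' ''a'' 0 = a" "s' ''b'' 0 = b" "\<forall>v<n. s' ''da'' v = d v a"
        using 2(2) s3 by (simp_all add: inp_def same_except_def)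
      have j: "s' ''j'' 0 < off (Suc b)" using 2(3) s' by simp
      have "off b \<le> s' ''j'' 0" using 2(1) by (simp add: enum_inv_def)
      then have da: "s' ''da'' (adj (s' ''j'' 0)) = d (adj (s' ''j'' 0)) a"
        using s' j adj_less ab_less by simp
      show ?case
      proof (cases "1 < d (adj (s' ''j'' 0)) a")
        case True
        then show ?thesis using enum_inv_add[OF 2(1) j True] j s'(1-4) da by (simp add: wp_simps)
      next
        case False
        then show ?thesis using enum_inv_skip[OF 2(1) j False] j s'(1-4) da by (simp add: wp_simps)
      qed
    next
      case (3 t' s')
      have s': "s' ''off'' = off" "s' ''b'' 0 = b" "\<forall>v<n. s' ''cnt'' v = 0" "s' ''e'' 0 = first"
        using 3(2) s3 by (simp_all add: inp_def same_except_def)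
      have j: "\<not> s' ''j'' 0 < off (Suc b)" using 3(3) s' by simp
      have "\<forall>i < s' ''m'' 0. s' ''out1'' i = a" using 3(1) by (simp add: enum_inv_def)
      then have "enum_result s'" using enum_inv_final[OF 3(1) j] s' by (simp add: enum_result_def)
      moreover have "off (Suc b) - s3 ''j'' 0 \<le> off n" using off_b by simp
      ultimately show ?case using 3(4) by simp
    qed
    have init: "enum_inv (out(0 := a)) (us(0 := b)) (s1 ''f'') first (off b)" for out us
      using s1(3) off_b by (auto simp: enum_inv_def first_def)
    have init': "enum_inv out us (s1 ''f'') first (off b)" if "{a, b} \<in> edges G" for out us
      using s1(3) off_b that by (auto simp: enum_inv_def first_def)
    have da_b: "s1 ''da'' b = d b a" using s1 ab_less by simp
    show ?case
    proof (cases "{a, b} \<in> edges G")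
      case True
      then have e: "first = 0" by (simp add: first_def)
      have c: "s1 ''a'' 0 = a" "s1 ''b'' 0 = b" "s1 ''off'' = off" using s1(1) by (simp_all add: inp_def)
      show ?thesis
        using dab True da_b c
        apply (simp add: wp_Write wp_If wp_Skip wp_Seq)
        apply (rule wp_mono[OF loop])
        using s1 init'[OF True] e s0(4) by (simp_all add: inp_def)
    next
      case False
      then have e: "first = 1" by (simp add: first_def)
      have c: "s1 ''a'' 0 = a" "s1 ''b'' 0 = b" "s1 ''off'' = off" using s1(1) by (simp_all add: inp_def)
      show ?thesis
        using dab False da_b c
        apply (simp add: wp_Write wp_If wp_Skip wp_Seq)
        apply (rule wp_mono[OF loop])
        using s1 init e s0(4) by (simp_all add: inp_def)
    qed
  qed (use s0 in \<open>simp_all add: inp_def same_except_def\<close>)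
qed (use s in \<open>simp_all add: inp_def same_except_def\<close>)

text \<open>Entries before \<open>h\<close> satisfy the final recurrence, those after
  \<open>h\<close> keep their initial value, and \<open>q h\<close> accounts for its list up to
  \<open>j\<close>. Quantifying over \<open>r\<close> expresses a minimum without a special case for
  empty sets.\<close>

definition rank_inv :: "(nat \<Rightarrow> nat) \<Rightarrow> (nat \<Rightarrow> nat) \<Rightarrow> (nat \<Rightarrow> nat) \<Rightarrow> nat \<Rightarrow> nat \<Rightarrow> bool" where
  "rank_inv F q f h j \<longleftrightarrow>
     (\<forall>i<h. \<forall>r. f (q i) \<le> r \<longleftrightarrow> F (q i) \<le> r \<or> (\<exists>x\<in>nbrs G (q i). d x b < d (q i) b \<and> f x \<le> r)) \<and>
     (\<forall>i. h < i \<longrightarrow> i < n \<longrightarrow> f (q i) = F (q i)) \<and> h \<le> n \<and>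
     (h < n \<longrightarrow> off (q h) \<le> j \<and> j \<le> off (Suc (q h)) \<and>
       (\<forall>r. f (q h) \<le> r \<longleftrightarrow>
         F (q h) \<le> r \<or> (\<exists>x\<in>adj ` {off (q h)..<j}. d x b < d (q h) b \<and> f x \<le> r)))"

context
  fixes D q assumes bfs_b: "bfs_result b D q"
begin

lemma q_less: "i < n \<Longrightarrow> q i < n"
  using bfs_b by (auto simp: bfs_result_def bij_betw_def)

lemma q_inj: "inj_on q {..<n}"
  using bfs_b by (simp add: bfs_result_def bij_betw_def)

lemma q_surj: "v < n \<Longrightarrow> \<exists>i<n. v = q i"
  using bfs_b by (auto simp: bfs_result_def bij_betw_def image_iff set_eq_iff)

lemma q_eq_iff: "i < n \<Longrightarrow> j < n \<Longrightarrow> q i = q j \<longleftrightarrow> i = j"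
  using inj_on_eq_iff[OF q_inj] by simp

lemma q_sorted: "i \<le> j \<Longrightarrow> j < n \<Longrightarrow> d (q i) b \<le> d (q j) b"
  using bfs_b by (simp add: bfs_result_def)

lemma rank_inv_init: "rank_inv F q F 0 (off (q 0))"
  using off_mono q_less by (auto simp: rank_inv_def)

lemma rank_inv_skip:
  assumes inv: "rank_inv F q f h j" and h: "h < n" and j: "j < off (Suc (q h))"
    and y: "\<not> d (adj j) b < d (q h) b \<or> \<not> f (adj j) < f (q h)"
  shows "rank_inv F q f h (Suc j)"
proof -
  have "off (q h) \<le> j" using inv h by (simp add: rank_inv_def)
  then have im: "adj ` {off (q h)..<Suc j} = insert (adj j) (adj ` {off (q h)..<j})"
    by (auto simp: less_Suc_eq)
  have old: "f (q h) \<le> r \<longleftrightarrow> F (q h) \<le> r \<or> (\<exists>x\<in>adj ` {off (q h)..<j}. d x b < d (q h) b \<and> f x \<le> r)" for r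
    using inv h by (simp add: rank_inv_def)
  have imp: "d (adj j) b < d (q h) b \<and> f (adj j) \<le> r \<Longrightarrow> f (q h) \<le> r" for r
    using y by linarith
  have "f (q h) \<le> r \<longleftrightarrow> F (q h) \<le> r \<or>
      (\<exists>x\<in>adj ` {off (q h)..<Suc j}. d x b < d (q h) b \<and> f x \<le> r)" for r
    unfolding im using old[of r] imp[of r] by blast
  then show ?thesis using inv h j unfolding rank_inv_def by simp
qed

lemma rank_inv_update:
  assumes inv: "rank_inv F q f h j" and h: "h < n" and j: "j < off (Suc (q h))"
    and y: "d (adj j) b < d (q h) b" "f (adj j) < f (q h)"
  shows "rank_inv F q (f(q h := f (adj j))) h (Suc j)"
proof -
  let ?f = "f(q h := f (adj j))"
  have "off (q h) \<le> j" using inv h by (simp add: rank_inv_def)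
  then have im: "adj ` {off (q h)..<Suc j} = insert (adj j) (adj ` {off (q h)..<j})"
    by (auto simp: less_Suc_eq)
  have old: "f (q h) \<le> r \<longleftrightarrow> F (q h) \<le> r \<or> (\<exists>x\<in>adj ` {off (q h)..<j}. d x b < d (q h) b \<and> f x \<le> r)" for r
    using inv h by (simp add: rank_inv_def)
  have same: "?f x = f x" if "d x b < d (q h) b" for x using that by auto
  have 1: "?f (q h) \<le> r \<longleftrightarrow> F (q h) \<le> r \<or>
      (\<exists>x\<in>adj ` {off (q h)..<Suc j}. d x b < d (q h) b \<and> ?f x \<le> r)" for r
  proof -
    have "?f (q h) \<le> r \<longleftrightarrow> f (q h) \<le> r \<or> f (adj j) \<le> r" using y(2) by auto
    then show ?thesis unfolding im using old[of r] y(1) same by auto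
  qed
  \<comment> \<open>The recurrence of an earlier vertex reads only vertices strictly closer to
    \<open>b\<close>, and \<open>q h\<close> is none of them.\<close>
  have 2: "?f (q i) \<le> r \<longleftrightarrow> F (q i) \<le> r \<or> (\<exists>x\<in>nbrs G (q i). d x b < d (q i) b \<and> ?f x \<le> r)"
    if i: "i < h" for i r
  proof -
    have "q i \<noteq> q h" using q_eq_iff[of i h] i h by simp
    moreover have "d (q i) b \<le> d (q h) b" using q_sorted i h by simp
    then have "d x b < d (q i) b \<Longrightarrow> ?f x = f x" for x using same[of x] by simp
    moreover have "f (q i) \<le> r \<longleftrightarrow> F (q i) \<le> r \<or> (\<exists>x\<in>nbrs G (q i). d x b < d (q i) b \<and> f x \<le> r)"
      using inv i by (simp add: rank_inv_def)
    ultimately show ?thesis by (metis fun_upd_other)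
  qed
  have 3: "?f (q i) = F (q i)" if "h < i" "i < n" for i
    using inv that q_eq_iff[of i h] h by (simp add: rank_inv_def)
  have 4: "h \<le> n" "off (q h) \<le> Suc j" "Suc j \<le> off (Suc (q h))"
    using inv h j by (simp_all add: rank_inv_def)
  show ?thesis unfolding rank_inv_def by (intro conjI allI impI 1 2 3 4)
qed

lemma rank_inv_advance:
  assumes inv: "rank_inv F q f h j" and h: "h < n" and j: "\<not> j < off (Suc (q h))"
  shows "rank_inv F q f (Suc h) (off (q (Suc h)))"
proof -
  have "j = off (Suc (q h))" using inv h j by (simp add: rank_inv_def)
  then have "f (q h) \<le> r \<longleftrightarrow> F (q h) \<le> r \<or> (\<exists>x\<in>nbrs G (q h). d x b < d (q h) b \<and> f x \<le> r)" for r
    using inv h nbrs_adj[OF q_less[OF h]] by (simp add: rank_inv_def)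
  then show ?thesis using inv h off_mono q_less by (auto simp: rank_inv_def less_Suc_eq)
qed

lemma rank_inv_final:
  assumes inv: "rank_inv F q f h j" and h: "\<not> h < n" and y: "y \<in> V"
  shows "f y \<le> r \<longleftrightarrow> F y \<le> r \<or> (\<exists>x. {x, y} \<in> edges G \<and> d x b < d y b \<and> f x \<le> r)"
proof -
  obtain i where i: "i < n" "y = q i" using q_surj y V_eq by auto
  then have "f y \<le> r \<longleftrightarrow> F y \<le> r \<or> (\<exists>x\<in>nbrs G y. d x b < d y b \<and> f x \<le> r)"
    using inv h by (simp add: rank_inv_def)
  then show ?thesis by (auto simp: nbrs_def insert_commute)
qed

end

lemma wp_propagate:
  assumes s: "inp s" "bfs_result b (s ''dist'') (s ''q'')"
  shows "wp propagate s (\<lambda>t s'. t \<le> 150 * (1 + n + off n) \<and>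
    (\<forall>y\<in>V. \<forall>r. s' ''f'' y \<le> r \<longleftrightarrow>
      s ''f'' y \<le> r \<or> (\<exists>x. {x, y} \<in> edges G \<and> d x b < d y b \<and> s' ''f'' x \<le> r)))"
  unfolding propagate_def wp_Seq wp_Write
proof (rule wp_While[where I = "\<lambda>s'. rank_inv (s ''f'') (s ''q'') (s' ''f'') (s' ''h'' 0) (s' ''j'' 0)
        \<and> s' ''j'' 0 \<ge> off (s ''q'' (s' ''h'' 0))"
      and \<Phi> = "\<lambda>s'. 100 * (n + off n - work (s ''q'') (s' ''h'' 0) (s' ''j'' 0))"], goal_cases)
  case 1
  show ?case using rank_inv_init[OF s(2)] s(1) by (simp add: inp_def)
next
  case (2 s')
  note bfs = s(2)
  define f q h j where "f = s' ''f''" and "q = s ''q''" and "h = s' ''h'' 0" and "j = s' ''j'' 0"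
  note defs = f_def[symmetric] q_def[symmetric] h_def[symmetric] j_def[symmetric]
  have s': "s' ''n'' 0 = n" "s' ''off'' = off" "s' ''adj'' = adj" "s' ''q'' = q" "s' ''dist'' = s ''dist''"
    using 2(2) s(1) by (simp_all add: inp_def same_except_def q_def)
  have inv: "rank_inv (s ''f'') q f h j" and h: "h < n" and jl: "off (q h) \<le> j"
    using 2(1,3) s' by (simp_all add: defs)
  note bfs = s(2)[folded q_def]
  have qh: "q h < n" using q_less[OF bfs h] .
  have w: "work q h j < n + off n"
    using inv h q_less[OF bfs] q_inj[OF bfs] by (intro work_less[of q n]) (auto simp: rank_inv_def)
  have dist: "v < n \<Longrightarrow> s ''dist'' v = d v b" for v using bfs by (simp add: bfs_result_def)
  show ?case
  proof (cases "j < off (Suc (q h))")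
    case True
    then have dy: "s ''dist'' (adj j) = d (adj j) b" "s ''dist'' (q h) = d (q h) b"
      using dist qh adj_less[OF qh jl] by simp_all
    show ?thesis
    proof (cases "d (adj j) b < d (q h) b \<and> f (adj j) < f (q h)")
      case y: True
      then show ?thesis using rank_inv_update[OF bfs inv h True] True w jl s' dy
        by (simp add: wp_simps defs work_Suc)
    next
      case y: False
      then have "\<not> d (adj j) b < d (q h) b \<or> \<not> f (adj j) < f (q h)" by blast
      from rank_inv_skip[OF bfs inv h True this] show ?thesis using y True w jl s' dy
        by (auto simp: wp_simps defs work_Suc)
    qed
  next
    case False
    then have "j = off (Suc (q h))" using inv h by (simp add: rank_inv_def)
    then show ?thesis using rank_inv_advance[OF bfs inv h False] w s'
      by (simp add: wp_simps defs work_advance)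
  qed
next
  case (3 t' s')
  have n: "s' ''n'' 0 = n" using 3(2) s(1) by (simp add: inp_def same_except_def)
  have inv: "rank_inv (s ''f'') (s ''q'') (s' ''f'') (s' ''h'' 0) (s' ''j'' 0)" and h: "\<not> s' ''h'' 0 < n"
    using 3(1,3) n by simp_all
  show ?case using rank_inv_final[OF s(2) inv h] 3(4) by simp
qed

end

section \<open>Choosing the prefix\<close>

text \<open>With truncated subtraction \<open>x - (x - y)\<close> is the minimum, so
  \<open>pa\<close> and \<open>pb\<close> become the totals after \<open>ab\<close> is present.
  \<open>cnt\<close> counts the vertices closer to \<open>b\<close> by their rank in
  \<open>f\<close>.\<close>

definition sum_dists :: prog where
  "sum_dists =
     Seq (assign ''i'' (Const 0))
    (Seq (assign ''sa'' (Const 0))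
    (Seq (assign ''sb'' (Const 0))
    (Seq (assign ''pa'' (Const 0))
    (Seq (assign ''pb'' (Const 0))
    (WhileLess (var ''i'') (var ''n'')
      (Seq (assign ''sa'' (Plus (var ''sa'') (Read ''da'' (var ''i''))))
      (Seq (assign ''sb'' (Plus (var ''sb'') (Read ''dist'' (var ''i''))))
      (Seq (assign ''pa'' (Plus (var ''pa'') (Minus (Read ''da'' (var ''i''))
             (Minus (Read ''da'' (var ''i'')) (Plus (Read ''dist'' (var ''i'')) (Const 1))))))
      (Seq (assign ''pb'' (Plus (var ''pb'') (Minus (Read ''dist'' (var ''i''))
             (Minus (Read ''dist'' (var ''i'')) (Plus (Read ''da'' (var ''i'')) (Const 1))))))
      (Seq (IfLess (Read ''dist'' (var ''i'')) (Read ''da'' (var ''i''))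
             (Write ''cnt'' (Read ''f'' (var ''i'')) (Plus (Read ''cnt'' (Read ''f'' (var ''i''))) (Const 1)))
             Skip)
        (incr ''i'')))))))))))"

text \<open>Index 0 gets the totals of \<open>G\<close> itself, because the formulas behind
  \<open>pa\<close> and \<open>pb\<close> presuppose \<open>ab\<close>; if \<open>ab\<close> is an
  edge of \<open>G\<close>, both writes agree.\<close>

definition prefix_totals :: prog where
  "prefix_totals =
     Seq (Write ''ta'' (Const 0) (var ''sa''))
    (Seq (Write ''tb'' (Const 0) (var ''sb''))
    (Seq (Write ''ta'' (var ''e'') (var ''pa''))
    (Seq (Write ''tb'' (var ''e'') (var ''pb''))
    (Seq (assign ''i'' (var ''e''))
    (WhileLess (var ''i'') (var ''m'')
      (Seq (Write ''ta'' (Plus (var ''i'') (Const 1))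
             (Minus (Read ''ta'' (var ''i'')) (Read ''cnt'' (Plus (var ''i'') (Const 1)))))
      (Seq (Write ''tb'' (Plus (var ''i'') (Const 1)) (Read ''tb'' (var ''i'')))
        (incr ''i''))))))))"

text \<open>Yields the two candidates as prefix lengths: the first sign change \<open>i\<close> and
  \<open>r = i - 1\<close>, or else \<open>i = k\<close> and \<open>r = 0\<close>. Setting
  \<open>lim\<close> to 0 leaves the loop.\<close>

definition search :: prog where
  "search =
     Seq (assign ''i'' (Const 0))
    (Seq (assign ''r'' (Const 0))
    (Seq (assign ''lim'' (var ''k''))
    (WhileLess (var ''i'') (var ''lim'')
      (Seq (incr ''i'')
        (IfLess (Read ''tb'' (var ''i'')) (Read ''ta'' (var ''i''))
          Skip
          (Seq (assign ''r'' (Minus (var ''i'') (Const 1)))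
            (assign ''lim'' (Const 0))))))))"

text \<open>Computes \<open>z = x y\<close> for \<open>x \<le> n\<^sup>2\<close> in time \<open>O(n)\<close>, first in units of \<open>n\<close>.\<close>

definition mult_loop1 :: prog where
  "mult_loop1 = WhileLess (var ''c'') (var ''n'')
     (Seq (assign ''w'' (Plus (var ''w'') (var ''y''))) (incr ''c''))"

definition mult_loop2 :: prog where
  "mult_loop2 = WhileLess (var ''n'') (Plus (var ''x'') (Const 1))
     (Seq (assign ''x'' (Minus (var ''x'') (var ''n''))) (assign ''z'' (Plus (var ''z'') (var ''w''))))"

definition mult_loop3 :: prog where
  "mult_loop3 = WhileLess (Const 0) (var ''x'')
     (Seq (assign ''x'' (Minus (var ''x'') (Const 1))) (assign ''z'' (Plus (var ''z'') (var ''y''))))"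

definition mult :: prog where
  "mult = Seq (assign ''z'' (Const 0)) (Seq (assign ''w'' (Const 0)) (Seq (assign ''c'' (Const 0))
     (Seq mult_loop1 (Seq mult_loop2 mult_loop3))))"

definition min_expr :: "string \<Rightarrow> expr" where
  "min_expr i = Minus (Read ''ta'' (var i)) (Minus (Read ''ta'' (var i)) (Read ''tb'' (var i)))"

definition max_expr :: "string \<Rightarrow> expr" where
  "max_expr i = Plus (Read ''ta'' (var i)) (Minus (Read ''tb'' (var i)) (Read ''ta'' (var i)))"

text \<open>Compares the two ratios by cross multiplication; on a tie the longer prefix
  \<open>i\<close> is kept.\<close>

definition compare :: prog where
  "compare =
     Seq (assign ''x'' (min_expr ''i''))
    (Seq (assign ''y'' (max_expr ''r''))
    (Seq mult
    (Seq (assign ''zi'' (var ''z''))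
    (Seq (assign ''x'' (min_expr ''r''))
    (Seq (assign ''y'' (max_expr ''i''))
    (Seq mult
      (IfLess (var ''zi'') (var ''z'')
        (assign ''out_count'' (var ''r''))
        (assign ''out_count'' (var ''i'')))))))))"

lemma wp_mult:
  assumes n: "0 < s ''n'' 0" and x: "s ''x'' 0 \<le> s ''n'' 0 * s ''n'' 0"
  shows "wp mult s (\<lambda>t s'. t \<le> 200 * (1 + s ''n'' 0) \<and> s' ''z'' 0 = s ''x'' 0 * s ''y'' 0)"
proof -
  define n x y where "n = s ''n'' 0" and "x = s ''x'' 0" and "y = s ''y'' 0"
  have n0: "0 < n" and x_le: "x \<le> n * n" using assms by (simp_all add: n_def x_def)
  have loop1: "wp mult_loop1 s (\<lambda>t s'. t \<le> 10 + 30 * n \<and> s' ''w'' 0 = n * y)"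
    if "s ''n'' 0 = n" "s ''y'' 0 = y" "s ''w'' 0 = 0" "s ''c'' 0 = 0" for s
    unfolding mult_loop1_def
  proof (rule wp_While[where I = "\<lambda>s. s ''w'' 0 = s ''c'' 0 * y \<and> s ''c'' 0 \<le> n"
        and \<Phi> = "\<lambda>s. 30 * (n - s ''c'' 0)"], goal_cases)
    case (2 s')
    have "s' ''n'' 0 = n" "s' ''y'' 0 = y" using 2(2) that by (simp_all add: same_except_def)
    then show ?case using 2(1,3) by (simp add: wp_simps)
  next
    case (3 t s')
    have "s' ''n'' 0 = n" using 3(2) that by (simp add: same_except_def)
    then have "s' ''c'' 0 = n" using 3(1,3) by simp
    then show ?case using 3(1,4) that by simp
  qed (use that in simp)
  have loop2: "wp mult_loop2 s (\<lambda>t s'. t \<le> 10 + 30 * n \<and> s' ''x'' 0 < n \<and> s' ''z'' 0 + s' ''x'' 0 * y = x * y)"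
    if "s ''n'' 0 = n" "s ''w'' 0 = n * y" "s ''x'' 0 = x" "s ''z'' 0 = 0" for s
    unfolding mult_loop2_def
  proof (rule wp_While[where I = "\<lambda>s. s ''z'' 0 + s ''x'' 0 * y = x * y"
        and \<Phi> = "\<lambda>s. 30 * (s ''x'' 0 div n)"], goal_cases)
    case (2 s')
    have s': "s' ''n'' 0 = n" "s' ''w'' 0 = n * y" using 2(2) that by (simp_all add: same_except_def)
    then have le: "n \<le> s' ''x'' 0" using 2(3) by simp
    then have "s' ''x'' 0 div n = Suc ((s' ''x'' 0 - n) div n)" using n0 by (simp add: le_div_geq)
    moreover have "n * y + (s' ''x'' 0 - n) * y = s' ''x'' 0 * y"
      using le by (simp add: distrib_right[symmetric])
    ultimately show ?case using 2(1) s' by (simp add: wp_simps)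
  next
    case (3 t s')
    have "s' ''n'' 0 = n" using 3(2) that by (simp add: same_except_def)
    \<comment> \<open>The second loop subtracts \<open>n\<close> at most \<open>n\<close> times
      since \<open>x \<le> n * n\<close>; the remainder below \<open>n\<close> bounds the
      third.\<close>
    moreover have "x div n \<le> n" using x_le n0 by (simp add: div_le_mono[of x "n * n" n, simplified])
    ultimately show ?case using 3(1,3,4) that by simp
  qed (use that in simp)
  have loop3: "wp mult_loop3 s (\<lambda>t s'. t \<le> 10 + 30 * n \<and> s' ''z'' 0 = x * y)"
    if "s ''y'' 0 = y" "s ''x'' 0 < n" "s ''z'' 0 + s ''x'' 0 * y = x * y" for s
    unfolding mult_loop3_def
  proof (rule wp_While[where I = "\<lambda>s. s ''z'' 0 + s ''x'' 0 * y = x * y"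
        and \<Phi> = "\<lambda>s. 30 * (s ''x'' 0)"], goal_cases)
    case (2 s')
    have s': "s' ''y'' 0 = y" using 2(2) that by (simp add: same_except_def)
    obtain x' where "s' ''x'' 0 = Suc x'" using 2(3) by (cases "s' ''x'' 0") auto
    then show ?case using 2(1) s' by (simp add: wp_simps)
  next
    case (3 t s')
    then show ?case using that by simp
  qed (use that in simp)
  have "wp mult s (\<lambda>t s'. t \<le> 200 * (1 + n) \<and> s' ''z'' 0 = x * y)"
    unfolding mult_def wp_Seq wp_Write
  proof (rule wp_mono[OF loop1], goal_cases)
    case (5 t1 s1)
    have s1: "s1 ''n'' 0 = n" "s1 ''x'' 0 = x" "s1 ''y'' 0 = y" "s1 ''z'' 0 = 0"
      using 5(2) by (simp_all add: same_except_def n_def x_def y_def mult_loop1_def)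
    show ?case
    proof (rule wp_mono[OF loop2], goal_cases)
      case (5 t2 s2)
      have s2: "s2 ''y'' 0 = y" using 5(2) s1 by (simp add: same_except_def mult_loop2_def)
      show ?case
      proof (rule wp_mono[OF loop3], goal_cases)
        case (4 t3 s3)
        then show ?case using 5(1) \<open>t1 \<le> 10 + 30 * n \<and> s1 ''w'' 0 = n * y\<close> by simp
      qed (use 5 s2 in simp_all)
    qed (use 5 s1 in simp_all)
  qed (simp_all add: n_def y_def)
  then show ?thesis by (simp add: n_def x_def y_def)
qed

lemma card_less_Suc_Collect:
  "card {v. v < Suc i \<and> P v} = card {v. v < i \<and> P v} + (if P i then 1 else 0)"
proof -
  have "{v. v < Suc i \<and> P v} = (if P i then insert i {v. v < i \<and> P v} else {v. v < i \<and> P v})"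
    by (auto simp: less_Suc_eq)
  then show ?thesis by simp
qed

lemma diff_diff_eq_min: "x - (x - y) = min x (y :: nat)"
  by auto

section \<open>Correctness of the prefix choice\<close>

locale encoded_star = encoded_instance G a b k n off adj + star_order G a b k us e\<^sub>0 M
  for G a b k n off adj us e\<^sub>0 M +
  fixes F :: "nat \<Rightarrow> nat"
  assumes F_cov: "x \<in> V \<Longrightarrow> i \<le> M \<Longrightarrow> F x \<le> i \<longleftrightarrow> cov i x"
begin

text \<open>For a prefix growing from \<open>r - 1\<close> to \<open>r\<close> edges with
  \<open>ab\<close> present, the number of vertices whose distance to \<open>a\<close>
  drops.\<close>

definition gain :: "nat \<Rightarrow> nat" where
  "gain r = card {v. v < n \<and> d v b < d v a \<and> F v = r}"

lemma M_less_n: "M < n"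
  using M_less by (simp add: V_eq)

lemma tA_first: "tA e\<^sub>0 = (\<Sum>v<n. min (d v a) (d v b + 1))"
proof -
  \<comment> \<open>Before any neighbour of \<open>b\<close> is joined, nothing is covered.\<close>
  have empty: "{x \<in> V. d x b < d x a \<and> F x \<le> e\<^sub>0} = {}"
    using F_cov[OF _ e0_le] by (auto simp: cov_def)
  have "tA e\<^sub>0 + card {x \<in> V. d x b < d x a \<and> F x \<le> e\<^sub>0} = (\<Sum>x\<in>V. min (d x a) (d x b + 1))"
    by (rule total_S_a[OF order_refl e0_le F_cov[OF _ e0_le]])
  then show ?thesis unfolding empty by (simp add: V_eq)
qed

lemma tB_eq: "e\<^sub>0 \<le> i \<Longrightarrow> i \<le> M \<Longrightarrow> tB i = (\<Sum>v<n. min (d v b) (d v a + 1))"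
  using total_S_b[of i] by (simp add: V_eq)

lemma tA_Suc:
  assumes "e\<^sub>0 \<le> i" "i < M"
  shows "tA (Suc i) = tA i - gain (Suc i)"
proof -
  let ?C = "\<lambda>i. {x \<in> V. d x b < d x a \<and> F x \<le> i}"
  have 1: "tA i + card (?C i) = (\<Sum>x\<in>V. min (d x a) (d x b + 1))"
    using total_S_a[of i F] F_cov assms by simp
  have 2: "tA (Suc i) + card (?C (Suc i)) = (\<Sum>x\<in>V. min (d x a) (d x b + 1))"
    using total_S_a[of "Suc i" F] F_cov assms by simp
  have "?C (Suc i) = ?C i \<union> {v. v < n \<and> d v b < d v a \<and> F v = Suc i}"
    using V_eq by (auto simp: le_Suc_eq)
  moreover have "card (?C i \<union> {v. v < n \<and> d v b < d v a \<and> F v = Suc i}) = card (?C i) + gain (Suc i)"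
    unfolding gain_def by (rule card_Un_disjoint) auto
  ultimately have "card (?C (Suc i)) = card (?C i) + gain (Suc i)" by (rule trans[OF arg_cong])
  then show ?thesis using 1 2 by linarith
qed

lemma tA_0: "tA 0 = (\<Sum>v<n. d v a)" and tB_0: "tB 0 = (\<Sum>v<n. d v b)"
  by (simp_all add: total_dist_def V_eq)

lemma wp_sum_dists:
  assumes s: "inp s" "\<forall>v<n. s ''da'' v = d v a" "\<forall>v<n. s ''dist'' v = d v b"
    "\<forall>v<n. s ''f'' v = F v" "\<forall>v<n. s ''cnt'' v = 0"
  shows "wp sum_dists s (\<lambda>t s'. t \<le> 200 * (1 + n) \<and> s' ''sa'' 0 = tA 0 \<and> s' ''sb'' 0 = tB 0 \<and>
    s' ''pa'' 0 = tA e\<^sub>0 \<and> s' ''pb'' 0 = tB e\<^sub>0 \<and> (\<forall>r<n. s' ''cnt'' r = gain r))"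
  unfolding sum_dists_def wp_Seq wp_Write
proof (rule wp_While[where I = "\<lambda>s. s ''i'' 0 \<le> n \<and> s ''sa'' 0 = (\<Sum>v < s ''i'' 0. d v a) \<and>
      s ''sb'' 0 = (\<Sum>v < s ''i'' 0. d v b) \<and>
      s ''pa'' 0 = (\<Sum>v < s ''i'' 0. min (d v a) (d v b + 1)) \<and>
      s ''pb'' 0 = (\<Sum>v < s ''i'' 0. min (d v b) (d v a + 1)) \<and>
      (\<forall>r<n. s ''cnt'' r = card {v. v < s ''i'' 0 \<and> d v b < d v a \<and> F v = r})"
      and \<Phi> = "\<lambda>s. 150 * (n - s ''i'' 0)"], goal_cases)
  case 1
  show ?case using s by simp
next
  case (2 s')
  have n: "s' ''n'' 0 = n" using 2(2) s by (simp add: inp_def same_except_def)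
  then have i: "s' ''i'' 0 < n" using 2(3) by simp
  have v: "s' ''da'' (s' ''i'' 0) = d (s' ''i'' 0) a" "s' ''dist'' (s' ''i'' 0) = d (s' ''i'' 0) b"
    "s' ''f'' (s' ''i'' 0) = F (s' ''i'' 0)"
    using 2(2) s i by (simp_all add: same_except_def)
  show ?case
  proof (cases "d (s' ''i'' 0) b < d (s' ''i'' 0) a")
    case True
    then show ?thesis using 2(1) i v
      by (simp add: wp_simps diff_diff_eq_min card_less_Suc_Collect)
  next
    case False
    then show ?thesis using 2(1) i v
      by (simp add: wp_simps diff_diff_eq_min card_less_Suc_Collect)
  qed
next
  case (3 t s')
  have n: "s' ''n'' 0 = n" using 3(2) s by (simp add: inp_def same_except_def)
  then have "s' ''i'' 0 = n" using 3(1,3) by simp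
  then show ?case using 3(1,4) tA_0 tB_0 tA_first tB_eq[OF order_refl e0_le] by (simp add: gain_def)
qed

lemma wp_prefix_totals:
  assumes s: "s ''sa'' 0 = tA 0" "s ''sb'' 0 = tB 0" "s ''pa'' 0 = tA e\<^sub>0" "s ''pb'' 0 = tB e\<^sub>0"
    "\<forall>r<n. s ''cnt'' r = gain r" "s ''e'' 0 = e\<^sub>0" "s ''m'' 0 = M"
  shows "wp prefix_totals s (\<lambda>t s'. t \<le> 100 * (1 + n) \<and> (\<forall>l\<le>M. s' ''ta'' l = tA l \<and> s' ''tb'' l = tB l))"
  unfolding prefix_totals_def wp_Seq wp_Write
proof (rule wp_While[where I = "\<lambda>s. e\<^sub>0 \<le> s ''i'' 0 \<and> s ''i'' 0 \<le> M \<and>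
      (\<forall>l \<le> s ''i'' 0. s ''ta'' l = tA l \<and> s ''tb'' l = tB l)"
      and \<Phi> = "\<lambda>s. 70 * (n - s ''i'' 0)"], goal_cases)
  case 1
  have "e\<^sub>0 = 0 \<or> e\<^sub>0 = 1" by (simp add: e0)
  then show ?case using s e0_le by (elim disjE) (auto simp: le_Suc_eq)
next
  case (2 s')
  have s': "s' ''m'' 0 = M" "\<forall>r<n. s' ''cnt'' r = gain r" using 2(2) s by (simp_all add: same_except_def)
  then have i: "s' ''i'' 0 < M" using 2(3) by simp
  have "tA (Suc (s' ''i'' 0)) = tA (s' ''i'' 0) - gain (Suc (s' ''i'' 0))"
    using tA_Suc[of "s' ''i'' 0"] 2(1) i by simp
  moreover have "tB (Suc (s' ''i'' 0)) = tB (s' ''i'' 0)" using tB_eq 2(1) i by simp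
  moreover have "s' ''cnt'' (Suc (s' ''i'' 0)) = gain (Suc (s' ''i'' 0))" using s' i M_less_n by simp
  ultimately show ?case using 2(1) i M_less_n by (simp add: wp_simps le_Suc_eq)
next
  case (3 t s')
  have "s' ''m'' 0 = M" using 3(2) s by (simp add: same_except_def)
  then have "s' ''i'' 0 = M" using 3(1,3) by simp
  then show ?case using 3(1,4) by simp
qed

definition chosen :: "nat \<Rightarrow> nat \<Rightarrow> bool" where
  "chosen i r \<longleftrightarrow> i \<le> M \<and> r \<le> M \<and>
     (r = 0 \<and> i = k \<and> (\<forall>l\<le>k. tB l < tA l) \<or>
      i = Suc r \<and> i \<le> k \<and> (\<forall>l\<le>r. tB l < tA l) \<and> tA i \<le> tB i)"

lemma chosen_steps:
  assumes "chosen i r" "larger_ratio G a b (S i) (S r) X"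
  shows "alg_steps G a b k Start (Return X)"
  using assms steps_Return_end[of X] steps_Return_found[of r X] by (auto simp: chosen_def)

lemma wp_search:
  assumes s: "s ''k'' 0 = k" "\<forall>l\<le>M. s ''ta'' l = tA l \<and> s ''tb'' l = tB l"
  shows "wp search s (\<lambda>t s'. t \<le> 100 * (1 + n) \<and> chosen (s' ''i'' 0) (s' ''r'' 0))"
  unfolding search_def wp_Seq wp_Write
proof (rule wp_While[where I = "\<lambda>s. s ''i'' 0 \<le> M \<and>
      (s ''lim'' 0 = k \<and> s ''r'' 0 = 0 \<and> s ''i'' 0 \<le> k \<and> (\<forall>l \<le> s ''i'' 0. tB l < tA l) \<or>
       s ''lim'' 0 = 0 \<and> s ''i'' 0 = Suc (s ''r'' 0) \<and> s ''i'' 0 \<le> k \<and>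
         (\<forall>l \<le> s ''r'' 0. tB l < tA l) \<and> tA (s ''i'' 0) \<le> tB (s ''i'' 0))"
      and \<Phi> = "\<lambda>s. 70 * (n - s ''i'' 0)"], goal_cases)
  case 1
  show ?case using s less by simp
next
  case (2 s')
  define i where "i = s' ''i'' 0"
  have I: "i \<le> M" "s' ''lim'' 0 = k" "s' ''r'' 0 = 0" "i < k" "\<forall>l\<le>i. tB l < tA l"
    using 2(1,3) by (auto simp: i_def)
  \<comment> \<open>The sign change at \<open>M\<close> keeps \<open>i\<close> within the
    enumeration although the program only tests \<open>i\<close> against \<open>k\<close>.\<close>
  then have iM: "i < M" using less_M by simp
  have t: "s' ''ta'' (Suc i) = tA (Suc i)" "s' ''tb'' (Suc i) = tB (Suc i)"
    using 2(2) s iM by (simp_all add: same_except_def)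
  show ?case
    using I iM t M_less_n by (cases "tB (Suc i) < tA (Suc i)") (simp_all add: wp_simps le_Suc_eq flip: i_def)
next
  case (3 t s')
  then show ?case using k by (auto simp: chosen_def)
qed

text \<open>Positivity justifies cross multiplication of the ratios; the bound \<open>n * n\<close>
  is what the linear-time multiplication requires.\<close>

lemma total_S_bounds:
  assumes "i \<le> M"
  shows "0 < tA i" "0 < tB i" "tA i \<le> n * n" "tB i \<le> n * n"
proof -
  interpret H: conn_graph "add_edges G (S i)"
    by (rule conn_graph_add_edges) (use S_non_edge assms in \<open>auto simp: S_def intro: non_edges_vpairs[THEN subsetD]\<close>)
  have "total_dist (add_edges G (S i)) v \<le> n * n" if "v < n" for v
  proof -
    have "total_dist (add_edges G (S i)) v \<le> (\<Sum>x<n. n)"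
      unfolding total_dist_def verts_add_edges V_eq
      using H.dist_less_card[of _ v] that by (intro sum_mono) (simp add: V_eq less_imp_le)
    then show ?thesis by simp
  qed
  then show "tA i \<le> n * n" "tB i \<le> n * n" using ab_less by simp_all
  show "0 < tA i" "0 < tB i" using H.total_dist_pos[of a b] H.total_dist_pos[of b a] ab by auto
qed

lemma larger_ratioI:
  assumes i: "i \<le> M" "r \<le> M"
    and l: "l = (if min (tA i) (tB i) * max (tA r) (tB r) < min (tA r) (tB r) * max (tA i) (tB i) then r else i)"
  shows "larger_ratio G a b (S i) (S r) (S l)"
proof -
  have m: "0 < real (max (tA i) (tB i))" "0 < real (max (tA r) (tB r))"
    using total_S_bounds(1)[OF i(1)] total_S_bounds(1)[OF i(2)] by (simp_all add: less_max_iff_disj)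
  have gen: "x / c \<le> y / e \<longleftrightarrow> x * e \<le> y * c" if "0 < c" "0 < e" for x y c e :: real
    using that by (simp add: field_simps)
  have le: "ratio (S r) \<le> ratio (S i) \<longleftrightarrow>
      real (min (tA r) (tB r)) * real (max (tA i) (tB i)) \<le> real (min (tA i) (tB i)) * real (max (tA r) (tB r))"
    unfolding closeness_ratio_def by (rule gen[OF m(2,1)])
  also have "\<dots> \<longleftrightarrow> min (tA r) (tB r) * max (tA i) (tB i) \<le> min (tA i) (tB i) * max (tA r) (tB r)"
    by (simp only: of_nat_mult[symmetric] of_nat_le_iff)
  finally show ?thesis using l by (auto simp: larger_ratio_def not_less)
qed

lemma wp_compare:
  assumes s: "s ''n'' 0 = n" "s ''i'' 0 = i" "s ''r'' 0 = r" "i \<le> M" "r \<le> M"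
    "\<forall>l\<le>M. s ''ta'' l = tA l \<and> s ''tb'' l = tB l"
  shows "wp compare s (\<lambda>t s'. t \<le> 500 * (1 + n) \<and> s' ''out_count'' 0 \<le> M \<and>
    larger_ratio G a b (S i) (S r) (S (s' ''out_count'' 0)))"
  unfolding compare_def wp_Seq wp_Write
proof (rule wp_mono[OF wp_mult], goal_cases)
  case 1
  then show ?case using s(1) ab_less by simp
next
  case 2
  then show ?case using s total_S_bounds(3)[OF s(4)] by (simp add: min_expr_def diff_diff_eq_min)
next
  case (3 t1 s1)
  have s1: "s1 ''n'' 0 = n" "s1 ''i'' 0 = i" "s1 ''r'' 0 = r" "\<forall>l\<le>M. s1 ''ta'' l = tA l \<and> s1 ''tb'' l = tB l"
    using 3(2) s by (simp_all add: same_except_def mult_def mult_loop1_def mult_loop2_def mult_loop3_def)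
  have z1: "s1 ''z'' 0 = min (tA i) (tB i) * max (tA r) (tB r)" and t1: "t1 \<le> 200 * (1 + n)"
    using 3(1) s by (auto simp: min_expr_def max_expr_def diff_diff_eq_min max_def)
  show ?case
  proof (rule wp_mono[OF wp_mult], goal_cases)
    case 1
    then show ?case using s1(1) ab_less by simp
  next
    case 2
    then show ?case using s1 total_S_bounds(3)[OF s(5)] s(5) by (simp add: min_expr_def diff_diff_eq_min)
  next
    case (3 t2 s2)
    have s2: "s2 ''i'' 0 = i" "s2 ''r'' 0 = r" "s2 ''zi'' 0 = min (tA i) (tB i) * max (tA r) (tB r)"
      using 3(2) s1 z1 by (simp_all add: same_except_def mult_def mult_loop1_def mult_loop2_def mult_loop3_def)
    have z2: "s2 ''z'' 0 = min (tA r) (tB r) * max (tA i) (tB i)" and t2: "t2 \<le> 200 * (1 + n)"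
      using 3(1) s1 s(4,5) by (auto simp: min_expr_def max_expr_def diff_diff_eq_min max_def)
    have c: "expr_cost (min_expr x) = 11" "expr_cost (max_expr x) = 11" for x
      by (simp_all add: min_expr_def max_expr_def)
    show ?case
      using larger_ratioI[OF s(4,5) refl] s(4,5) s2 z2 t1 t2 c by (simp add: wp_simps split: if_splits)
  qed
qed

end

section \<open>The whole program\<close>

text \<open>The distances to \<open>a\<close> are saved in \<open>da\<close> before the second
  search overwrites \<open>dist\<close>; searching from \<open>b\<close> last leaves
  \<open>q\<close> sorted by distance to \<open>b\<close>.\<close>

definition main_prog :: prog where
  "main_prog =
     Seq (assign ''src'' (var ''a''))
    (Seq bfs
    (Seq (fill ''da'' (Read ''dist'' (var ''i'')))
    (Seq (assign ''src'' (var ''b''))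
    (Seq bfs
    (Seq enum_nbrs
    (Seq propagate
    (Seq sum_dists
    (Seq prefix_totals
    (Seq search
      compare)))))))))"

lemma writes_subprogs:
  "writes bfs = {''dist'', ''i'', ''q'', ''h'', ''t'', ''j'', ''y''}"
  "writes (fill x e) = {''i'', x}"
  "writes enum_nbrs = {''f'', ''i'', ''cnt'', ''m'', ''out1'', ''out2'', ''e'', ''j'', ''y''}"
  "writes propagate = {''h'', ''j'', ''y'', ''f''}"
  "writes sum_dists = {''i'', ''sa'', ''sb'', ''pa'', ''pb'', ''cnt''}"
  "writes prefix_totals = {''ta'', ''tb'', ''i''}"
  "writes search = {''i'', ''r'', ''lim''}"
  "writes compare = {''x'', ''y'', ''z'', ''w'', ''c'', ''zi'', ''out_count''}"
  by (auto simp: bfs_def fill_def enum_nbrs_def enum_loop_def propagate_def sum_dists_def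
      prefix_totals_def search_def compare_def mult_def mult_loop1_def mult_loop2_def mult_loop3_def)

lemma (in encoded_star) wp_choose:
  assumes s: "inp s" "\<forall>v<n. s ''da'' v = d v a" "\<forall>v<n. s ''dist'' v = d v b"
    "\<forall>v<n. s ''f'' v = F v" "\<forall>v<n. s ''cnt'' v = 0"
    "s ''e'' 0 = e\<^sub>0" "s ''m'' 0 = M" "s ''out2'' = us" "\<forall>i<M. s ''out1'' i = a"
  shows "wp (Seq sum_dists (Seq prefix_totals (Seq search compare))) s
    (\<lambda>t s'. t \<le> 1000 * (1 + n) \<and> alg_steps G a b k Start (Return (output_edges s')))"
  unfolding wp_Seq
proof (rule wp_mono[OF wp_sum_dists[OF s(1-5)]], goal_cases)
  case (1 t1 s1)
  have s1: "s1 ''n'' 0 = n" "s1 ''k'' 0 = k" "s1 ''e'' 0 = e\<^sub>0" "s1 ''m'' 0 = M" "s1 ''out2'' = us"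
    "\<forall>i<M. s1 ''out1'' i = a"
    using 1(2) s by (simp_all add: same_except_def writes_subprogs inp_def)
  have t1: "t1 \<le> 200 * (1 + n)" using 1(1) by simp
  show ?case
  proof (rule wp_mono[OF wp_prefix_totals], goal_cases)
    case (8 t2 s2)
    have s2: "s2 ''n'' 0 = n" "s2 ''k'' 0 = k" "s2 ''out2'' = us" "\<forall>i<M. s2 ''out1'' i = a"
      using 8(2) s1 by (simp_all add: same_except_def writes_subprogs)
    have tot: "\<forall>l\<le>M. s2 ''ta'' l = tA l \<and> s2 ''tb'' l = tB l" and t2: "t2 \<le> 100 * (1 + n)"
      using 8(1) by simp_all
    show ?case
    proof (rule wp_mono[OF wp_search[OF s2(2) tot]], goal_cases)
      case (1 t3 s3)
      have s3: "s3 ''n'' 0 = n" "s3 ''out2'' = us" "\<forall>i<M. s3 ''out1'' i = a"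
        "\<forall>l\<le>M. s3 ''ta'' l = tA l \<and> s3 ''tb'' l = tB l"
        using 1(2) s2 tot by (simp_all add: same_except_def writes_subprogs)
      have t3: "t3 \<le> 100 * (1 + n)" and ch: "chosen (s3 ''i'' 0) (s3 ''r'' 0)" using 1(1) by simp_all
      then have le: "s3 ''i'' 0 \<le> M" "s3 ''r'' 0 \<le> M" by (simp_all add: chosen_def)
      show ?case
      proof (rule wp_mono[OF wp_compare[OF s3(1) refl refl le s3(4)]], goal_cases)
        case (1 t4 s4)
        have s4: "s4 ''out2'' = us" "\<forall>i<M. s4 ''out1'' i = a"
          using 1(2) s3 by (simp_all add: same_except_def writes_subprogs)
        have "output_edges s4 = (\<lambda>i. {s4 ''out1'' i, us i}) ` {..<s4 ''out_count'' 0}"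
          using s4(1) by (auto simp: output_edges_def)
        also have "\<dots> = S (s4 ''out_count'' 0)"
          unfolding S_def using s4(2) 1(1) by (intro image_cong) auto
        finally have "output_edges s4 = S (s4 ''out_count'' 0)" .
        then show ?case using chosen_steps[OF ch] 1(1) t1 t2 t3 by simp
      qed
    qed
  qed (use 1(1) s1 in simp_all)
qed

context encoded_instance
begin

lemma wp_main_prog:
  assumes s: "inp s"
  shows "wp main_prog s
    (\<lambda>t s'. t \<le> 2000 * (1 + n + off n) \<and> alg_steps G a b k Start (Return (output_edges s')))"
proof -
  \<comment> \<open>The 15 consists of two assignments of cost 4 and seven sequencing nodes.\<close>
  have main: "wp main_prog s Q \<longleftrightarrow> wp bfs (s(''src'' := (s ''src'')(0 := a))) (\<lambda>t1 s1.
    wp (fill ''da'' (Read ''dist'' (var ''i''))) s1 (\<lambda>t2 s2.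
    wp bfs (s2(''src'' := (s2 ''src'')(0 := s2 ''b'' 0))) (\<lambda>t3 s3.
    wp enum_nbrs s3 (\<lambda>t4 s4. wp propagate s4 (\<lambda>t5 s5.
    wp (Seq sum_dists (Seq prefix_totals (Seq search compare))) s5 (\<lambda>t6 s6.
      Q (15 + t1 + t2 + t3 + t4 + t5 + t6) s6))))))" for Q
    unfolding main_prog_def wp_Seq wp_Write using s
    by (simp add: inp_def ac_simps numeral_eq_Suc)
  show ?thesis unfolding main
  proof (rule wp_mono[OF wp_bfs[of _ a]], goal_cases)
    case (4 t1 s1)
    have s1: "inp s1" using 4(2) s by (simp add: same_except_def writes_subprogs inp_def)
    have bfs1: "\<forall>v<n. s1 ''dist'' v = d v a" and t1: "t1 \<le> 200 * (1 + n + off n)"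
      using 4(1) by (simp_all add: bfs_result_def)
    show ?case
    proof (rule wp_mono[OF wp_fill[where c = "s1 ''dist''"]], goal_cases)
      case (5 t2 s2)
      have s2: "inp s2" using 5(2) s1 by (simp add: same_except_def writes_subprogs inp_def)
      have n1: "s1 ''n'' 0 = n" using s1 by (simp add: inp_def)
      have da2: "\<forall>v<n. s2 ''da'' v = d v a" and t2: "t2 \<le> 40 * (1 + n)"
        using 5(1) n1 bfs1 by simp_all
      show ?case
      proof (rule wp_mono[OF wp_bfs[of _ b]], goal_cases)
        case (4 t3 s3)
        have s3: "inp s3" "\<forall>v<n. s3 ''da'' v = d v a"
          using 4(2) s2 da2 by (simp_all add: same_except_def writes_subprogs inp_def)
        have bfs3: "bfs_result b (s3 ''dist'') (s3 ''q'')" and t3: "t3 \<le> 200 * (1 + n + off n)"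
          using 4(1) by simp_all
        show ?case
        proof (rule wp_mono[OF wp_enum_nbrs[OF s3]], goal_cases)
          case (1 t4 s4)
          have s4: "inp s4" "\<forall>v<n. s4 ''da'' v = d v a" "bfs_result b (s4 ''dist'') (s4 ''q'')"
            using 1(2) s3 bfs3 by (simp_all add: same_except_def writes_subprogs inp_def)
          have t4: "t4 \<le> 300 * (1 + n + off n)" and enum: "enum_result s4" using 1(1) by simp_all
          show ?case
          proof (rule wp_mono[OF wp_propagate[OF s4(1,3)]], goal_cases)
            case (1 t5 s5)
            have s5: "inp s5" "\<forall>v<n. s5 ''da'' v = d v a" "\<forall>v<n. s5 ''dist'' v = d v b"
              "\<forall>v<n. s5 ''cnt'' v = 0" "s5 ''e'' 0 = s4 ''e'' 0" "s5 ''m'' 0 = s4 ''m'' 0"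
              "s5 ''out2'' = s4 ''out2''" "\<forall>i < s4 ''m'' 0. s5 ''out1'' i = a"
              using 1(2) s4 enum
              by (simp_all add: same_except_def writes_subprogs inp_def enum_result_def bfs_result_def)
            interpret star_order G a b k "s4 ''out2''" "s4 ''e'' 0" "s4 ''m'' 0"
              using enum by (simp add: enum_result_def)
            have t5: "t5 \<le> 150 * (1 + n + off n)" using 1(1) by simp
            have "s5 ''f'' x \<le> i \<longleftrightarrow> cov i x" if "x \<in> V" "i \<le> s4 ''m'' 0" for x i
              by (rule rank_cov[where F\<^sub>0 = "s4 ''f''"]) (use 1(1) enum that in \<open>auto simp: enum_result_def\<close>)
            then interpret encoded_star G a b k n off adj "s4 ''out2''" "s4 ''e'' 0" "s4 ''m'' 0" "s5 ''f''"
              by unfold_locales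
            show ?case
            proof (rule wp_mono[OF wp_choose], goal_cases)
              case (10 t6 s6)
              then show ?case using t1 t2 t3 t4 t5 by simp
            qed (use s5 in simp_all)
          qed
        qed
      qed (use s2 ab_less in \<open>simp_all add: inp_def\<close>)
    qed (simp_all add: same_except_def)
  qed (use s ab_less in \<open>simp_all add: inp_def\<close>)
qed

end

lemma main_prog_correct:
  assumes "alg_input G a b k" "encodes_input s G a b k"
  shows "\<exists>t s'. runs main_prog s t s' \<and> t \<le> 6000 * (card (verts G) + card (edges G)) \<and>
    alg_steps G a b k Start (Return (output_edges s'))"
proof -
  interpret encoded_instance G a b k "s ''n'' 0" "s ''off''" "s ''adj''"
    using assms by unfold_locales (auto simp: encodes_input_def)
  have "inp s" using assms by (simp add: inp_def encodes_input_def)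
  from wp_main_prog[OF this] obtain t s' where
    "runs main_prog s t s'" "t \<le> 2000 * (1 + s ''n'' 0 + s ''off'' (s ''n'' 0))"
    "alg_steps G a b k Start (Return (output_edges s'))"
    by (auto simp: wp_def)
  \<comment> \<open>\<open>off n\<close> is at most twice the number of edges, and
    \<open>n \<ge> 1\<close> absorbs the constant.\<close>
  moreover have "2000 * (1 + s ''n'' 0 + s ''off'' (s ''n'' 0)) \<le> 6000 * (card (verts G) + card (edges G))"
    using off_n_le ab_less card_V by simp
  ultimately show ?thesis using order_trans by blast
qed

lemma implements_main_prog: "implements_alg main_prog"
  using main_prog_correct by (fastforce simp: implements_alg_def)

lemma time_main_prog: "runs_in_time main_prog"
  unfolding runs_in_time_def
proof (intro exI[of _ 6000] allI impI, elim conjE)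
  fix G a b k s t s'
  assume "alg_input G a b k" "encodes_input s G a b k" "runs main_prog s t s'"
  \<comment> \<open>Determinism carries the bound from the run exhibited to every run.\<close>
  then have "t \<le> 6000 * (card (verts G) + card (edges G))"
    using main_prog_correct runs_deterministic by blast
  then have "real t \<le> 6000 * real (card (verts G) + card (edges G))" by (metis of_nat_le_iff of_nat_mult of_nat_numeral)
  also have "\<dots> \<le> 6000 * (real (card (verts G) + card (edges G)) * max 1 (log 2 (real k)))"
    by (intro mult_left_mono) (auto simp: mult_le_cancel_left1)
  finally show "real t \<le> 6000 * (real (card (verts G) + card (edges G)) * max 1 (log 2 (real k)))" .
qed

theorem theorem4:
  shows "(\<forall>(G :: 'a ugraph) a b k. alg_input G a b k \<longrightarrow>
            alg_terminates G a b k \<and>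
            (\<forall>c. alg_halts_in G a b k c \<longrightarrow>
               (\<exists>S. c = Return S \<and> S \<subseteq> non_edges G \<and> card S \<le> k \<and>
                    closeness_ratio (add_edges G S) a b \<ge> 6 / 11 * opt G a b k))) \<and>
         (\<exists>p. implements_alg p \<and> runs_in_time p)"
proof (intro conjI allI impI)
  fix G :: "'a ugraph" and a b k
  assume "alg_input G a b k"
  then interpret alg_instance G a b k by unfold_locales
  show "alg_terminates G a b k" by (rule terminates)
  fix c assume "alg_halts_in G a b k c"
  then show "\<exists>S. c = Return S \<and> S \<subseteq> non_edges G \<and> card S \<le> k \<and> 6 / 11 * opt G a b k \<le> ratio S"
    using halts_in_Return approximation_ratio by (metis good_def)
next
  show "\<exists>p. implements_alg p \<and> runs_in_time p"
    using implements_main_prog time_main_prog by blast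
qed

end
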